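(* There exists a planar hypotraceable graph with exactly $162$ vertices. That is, there exists a planar graph $G$ with $|V(G)| = 162$ such that $G$ does not contain a Hamiltonian path, but for every vertex $v \in V(G)$ the graph $G - v$ contains a Hamiltonian path.
   Context: Graphs are finite, simple and undirected. A Hamiltonian path of a graph is a path passing through all of its vertices. For a vertex $v$ of $G$, $G - v$ denotes the graph obtained from $G$ by deleting $v$ and all edges incident to it. A graph is called hypotraceable if it does not contain a Hamiltonian path but the deletion of any single vertex gives a graph having a Hamiltonian path. *)

theory Defs
  imports
    "HOL-Analysis.Analysis"
    "Graph_Theory.Pair_Digraph"
    "Graph_Theory.Vertex_Walk"
begin

text \<open>
  Finite simple undirected graphs are the finite symmetric loop-free digraphs without parallel
  arcs (locales \<open>graph\<close> and \<open>pair_graph\<close>): an undirected edge is a pair of opposite arcs.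
\<close>

definition hamiltonian_path :: "('a, 'b) pre_digraph \<Rightarrow> 'a vwalk \<Rightarrow> bool" where
  "hamiltonian_path G p \<longleftrightarrow> vpath p G \<and> set p = verts G"

definition hypotraceable :: "('a, 'b) pre_digraph \<Rightarrow> bool" where
  "hypotraceable G \<longleftrightarrow>
     (\<nexists>p. hamiltonian_path G p) \<and>
     (\<forall>v \<in> verts G. \<exists>p. hamiltonian_path (pre_digraph.del_vert G v) p)"

definition undirected_edges :: "('a, 'b) pre_digraph \<Rightarrow> 'a set set" where
  "undirected_edges G = (\<lambda>(u, v). {u, v}) ` arcs_ends G"

text \<open>
  A drawing without crossings in the Euclidean plane: \<open>pos\<close> places the vertices and \<open>crv e\<close> is the
  point set of the curve representing the edge \<open>e\<close>. Since curves are indexed by undirected edges,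
  the two opposite arcs of an edge share one curve. Here \<open>arc\<close> is the injective path of the
  topology library, not an arc of a digraph.
\<close>
definition plane_drawing ::
    "('a, 'b) pre_digraph \<Rightarrow> ('a \<Rightarrow> real ^ 2) \<Rightarrow> ('a set \<Rightarrow> (real ^ 2) set) \<Rightarrow> bool" where
  "plane_drawing G pos crv \<longleftrightarrow>
     inj_on pos (verts G) \<and>
     (\<forall>(u, v) \<in> arcs_ends G.
        \<exists>g. arc g \<and> pathstart g = pos u \<and> pathfinish g = pos v \<and> path_image g = crv {u, v}) \<and>
     (\<forall>e \<in> undirected_edges G. crv e \<inter> pos ` verts G \<subseteq> pos ` e) \<and>
     (\<forall>e \<in> undirected_edges G. \<forall>f \<in> undirected_edges G.
        e \<noteq> f \<longrightarrow> crv e \<inter> crv f \<subseteq> pos ` (e \<inter> f))"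

definition planar :: "('a, 'b) pre_digraph \<Rightarrow> bool" where
  "planar G \<longleftrightarrow> (\<exists>pos crv. plane_drawing G pos crv)"

end

(*
  Thomassen's construction. Let G be a graph without a Hamiltonian cycle all of whose vertex-deleted
  subgraphs have one, and let v be a vertex of degree 3 with neighbours x, y, z. Take four copies
  H0, ..., H3 of the fragment G - v, identify the copies of x in H0 and H1 and those in H2 and H3,
  and join the copies of y and of z in H0 and H2, and in H1 and H3. A planar G with 42 vertices
  gives a planar graph with 4 * 41 - 2 = 162 vertices.

  Regard a Hamiltonian path of the glued graph as a set of used edges. If a copy contains no end of
  the path (apart possibly from its copy of x), then no used edge joins its copy of x to the rest
  of that copy: otherwise the used edges of the copy, completed by edges at v, would form a
  Hamiltonian cycle of G. At least two copies contain no end, and for any two such copies some cut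
  of the glued graph contains no used edge.

  For the deleted vertices, the Hamiltonian cycles of the graphs G - a give Hamiltonian paths of
  the fragment minus a between two of x, y, z, which extend through the other three copies.

  For planarity, the fragment is drawn with straight lines in the first quadrant, x on the vertical
  axis and y, z lowest; the four copies are its reflections in the coordinate axes.

  The graph G has one quadrilateral and 26 pentagonal faces, so by Grinberg's criterion it has no
  Hamiltonian cycle. Here this is derived from a list of cuts instead: no 2-factor meets all of them.
*)
theory Submission
  imports Defs
begin

section \<open>The 42-vertex graph\<close>

text \<open>The neighbours of vertex 41 are 40 (the apex of the fragment) and 38, 39 (its corners).\<close>
definition hypo_edges :: "(nat \<times> nat) list" where
  "hypo_edges =
    [(0, 1), (0, 3), (0, 4), (0, 7), (1, 2), (1, 6), (1, 12), (2, 3), (2, 14), (2, 17),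
     (3, 10), (3, 19), (4, 5), (4, 9), (5, 6), (5, 24), (6, 15), (7, 8), (7, 11), (8, 9),
     (8, 26), (9, 23), (10, 11), (10, 38), (11, 39), (12, 13), (12, 16), (13, 14), (13, 29),
     (14, 20), (15, 16), (15, 25), (16, 28), (17, 18), (17, 21), (18, 19), (18, 33), (19, 22),
     (20, 21), (20, 30), (21, 32), (22, 34), (22, 38), (23, 24), (23, 27), (23, 36), (24, 25),
     (25, 31), (25, 37), (26, 27), (26, 39), (27, 40), (28, 29), (28, 31), (29, 30), (30, 35),
     (31, 35), (32, 33), (32, 35), (32, 37), (33, 34), (34, 36), (34, 40), (36, 37), (38, 41),
     (39, 41), (40, 41)]"

lemma upt_41: "[0..<41] =
    [0, 1, 2, 3, 4, 5, 6, 7, 8, 9, 10, 11, 12, 13, 14, 15, 16, 17, 18, 19, 20, 21, 22, 23, 24,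
     25, 26, 27, 28, 29, 30, 31, 32, 33, 34, 35, 36, 37, 38, 39, 40]"
  by (simp add: upt_rec)

lemma upt_42: "[0..<42] = [0..<41] @ [41]"
  using upt_Suc_append[of 0 41] by simp

text \<open>
  Simplification restricted to these rules, with \<open>if_weak_cong\<close>, decides membership in lists of
  numerals much faster than the default simpset.
\<close>
lemmas numeral_list_simps =
  filter.simps fst_conv snd_conv list.set insert_iff empty_iff simp_thms if_True if_False
  eq_num_simps numeral_eq_iff numeral_eq_one_iff one_eq_numeral_iff
  zero_neq_numeral numeral_neq_zero zero_neq_one one_neq_zero
  list.pred_inject list_ex_Nil_iff list_ex_Cons_iff

lemma hypo_edges_ordered: "(a, b) \<in> set hypo_edges \<Longrightarrow> a < b \<and> b \<le> 41"
  by (auto simp: hypo_edges_def)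

lemma hypo_edges_41: "(a, 41) \<in> set hypo_edges \<longleftrightarrow> a \<in> {38, 39, 40}"
  by (auto simp: hypo_edges_def)

definition fragment_adj :: "nat \<Rightarrow> nat \<Rightarrow> bool" where
  "fragment_adj a b \<longleftrightarrow> b \<noteq> 41 \<and> a \<noteq> 41 \<and> ((a, b) \<in> set hypo_edges \<or> (b, a) \<in> set hypo_edges)"

lemma fragment_adj_sym: "fragment_adj a b \<longleftrightarrow> fragment_adj b a"
  by (auto simp: fragment_adj_def)

lemma fragment_adj_range: "fragment_adj a b \<Longrightarrow> a \<le> 40 \<and> b \<le> 40 \<and> a \<noteq> b"
  by (auto simp: fragment_adj_def dest: hypo_edges_ordered)

section \<open>The graph has no Hamiltonian cycle\<close>

definition incident_edges :: "nat \<Rightarrow> (nat \<times> nat) list" where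
  "incident_edges a = filter (\<lambda>e. fst e = a \<or> snd e = a) hypo_edges"

definition crossing_edges :: "nat list \<Rightarrow> (nat \<times> nat) list" where
  "crossing_edges S = filter (\<lambda>e. (fst e \<in> set S) \<noteq> (snd e \<in> set S)) hypo_edges"

definition exactly_two :: "('a \<Rightarrow> bool) \<Rightarrow> 'a list \<Rightarrow> bool" where
  "exactly_two W xs \<longleftrightarrow> length (filter W xs) = 2"

text \<open>All degrees in the graph are 3 or 4, so these two lengths cover every vertex; the
  clausal form suits \<open>sat\<close>.\<close>

lemma exactly_two_cnf:
  "exactly_two W [a, b, c] \<longleftrightarrow>
    (W a \<or> W b) \<and> (W a \<or> W c) \<and> (W b \<or> W c) \<and> (\<not> W a \<or> \<not> W b \<or> \<not> W c)"
  "exactly_two W [a, b, c, d] \<longleftrightarrow>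
    (W a \<or> W b \<or> W c) \<and> (W a \<or> W b \<or> W d) \<and> (W a \<or> W c \<or> W d) \<and> (W b \<or> W c \<or> W d) \<and>
    (\<not> W a \<or> \<not> W b \<or> \<not> W c) \<and> (\<not> W a \<or> \<not> W b \<or> \<not> W d) \<and>
    (\<not> W a \<or> \<not> W c \<or> \<not> W d) \<and> (\<not> W b \<or> \<not> W c \<or> \<not> W d)"
  by (simp_all add: exactly_two_def)

text \<open>
  Every 2-factor of the graph violates one of these cuts; they are vertex sets of cycles of
  2-factors, or complements of such sets.
\<close>
definition subtour_cuts :: "nat list list" where
  "subtour_cuts =
    [[0,4,7,8,9], [1,6,12,15,16], [2,14,17,20,21], [3,10,19,22,38], [4,5,9,23,24],
     [5,6,15,24,25], [7,8,11,26,39], [8,9,23,26,27], [12,13,16,28,29], [13,14,20,29,30],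
     [15,16,25,28,31], [17,18,21,32,33], [18,19,22,33,34], [20,21,30,32,35], [23,24,25,36,37],
     [28,29,30,31,35], [32,33,34,36,37], [0,3,4,7,8,9,10,11], [0,3,7,10,11,19,22,38],
     [0,4,5,7,8,9,23,24], [0,4,7,8,9,11,26,39], [1,2,6,12,13,14,15,16],
     [1,2,12,13,14,17,20,21], [1,5,6,12,15,16,24,25], [1,6,12,13,15,16,28,29],
     [2,13,14,17,20,21,29,30], [2,14,17,18,20,21,32,33], [3,10,18,19,22,33,34,38],
     [4,5,6,9,15,23,24,25], [4,5,8,9,23,24,26,27], [4,5,9,23,24,25,36,37],
     [5,6,15,16,24,25,28,31], [5,6,15,23,24,25,36,37], [12,13,16,28,29,30,31,35],
     [13,14,20,28,29,30,31,35], [15,16,25,28,29,30,31,35], [17,18,19,21,22,32,33,34],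
     [17,18,20,21,30,32,33,35], [17,18,21,32,33,34,36,37], [18,19,22,32,33,34,36,37],
     [20,21,28,29,30,31,32,35], [23,24,25,32,33,34,36,37], [25,28,29,30,31,32,35,37],
     [0,1,2,3,4,7,8,9,10,11], [0,1,2,3,6,12,13,14,15,16], [0,1,2,3,7,10,11,19,22,38],
     [0,1,2,3,12,13,14,17,20,21], [1,6,12,13,15,16,28,29,30,31,35],
     [2,13,14,17,20,21,28,29,30,31,35], [4,5,6,8,9,15,23,24,25,26,27],
     [4,5,6,9,15,16,23,24,25,28,31], [4,5,8,9,23,24,25,26,27,36,37],
     [4,5,9,23,24,25,27,34,36,37,40], [5,6,15,16,23,24,25,28,31,36,37],
     [5,6,15,16,24,25,28,29,30,31,35], [5,6,15,23,24,25,31,32,35,36,37],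
     [17,18,19,20,21,22,30,32,33,34,35], [17,18,20,21,28,29,30,31,32,33,35],
     [17,18,20,21,30,32,33,34,35,36,37], [17,18,21,25,31,32,33,34,35,36,37],
     [18,19,22,23,27,32,33,34,36,37,40], [0,1,2,3,4,7,8,9,10,11,12,13,14],
     [0,1,2,3,4,7,8,9,10,11,19,22,38], [0,1,2,3,6,7,10,11,12,13,14,15,16],
     [0,1,2,3,6,12,13,14,15,16,17,20,21], [0,1,2,3,7,10,11,12,13,14,17,20,21],
     [0,1,2,3,7,10,11,12,13,14,19,22,38], [1,2,6,12,13,14,15,16,17,20,21,28,29,30],
     [1,2,6,12,13,14,15,16,20,28,29,30,31,35], [1,2,12,13,14,16,17,20,21,28,29,30,31,35],
     [1,5,6,12,13,15,16,24,25,28,29,30,31,35], [2,13,14,17,18,20,21,28,29,30,31,32,33,35],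
     [4,5,6,9,15,16,23,24,25,28,29,30,31,35], [4,5,7,8,9,11,23,24,25,26,27,36,37,39],
     [4,5,9,17,18,21,23,24,25,32,33,34,36,37], [4,5,9,23,24,25,28,29,30,31,32,35,36,37],
     [5,6,12,13,15,16,23,24,25,28,29,31,36,37], [5,6,15,16,23,24,25,28,29,30,31,35,36,37],
     [5,6,15,18,19,22,23,24,25,32,33,34,36,37], [5,6,15,20,21,23,24,25,30,31,32,35,36,37],
     [8,9,18,19,22,23,26,27,32,33,34,36,37,40], [13,14,17,18,20,21,29,30,32,33,34,35,36,37],
     [15,16,17,18,21,25,28,31,32,33,34,35,36,37], [17,18,19,20,21,22,28,29,30,31,32,33,34,35],
     [17,18,20,21,28,29,30,31,32,33,34,35,36,37], [18,19,22,25,28,29,30,31,32,33,34,35,36,37],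
     [0,1,2,3,4,7,8,9,10,11,12,13,14,16,28,29], [0,1,2,3,4,7,8,9,10,11,12,13,14,17,20,21],
     [0,1,2,3,4,7,8,9,10,11,12,13,14,19,22,38], [0,1,2,3,6,7,8,10,11,12,13,14,15,16,26,39],
     [0,1,2,3,6,7,10,11,12,13,14,15,16,17,20,21], [0,1,2,3,6,7,10,11,12,13,14,15,16,19,22,38],
     [0,1,2,3,6,12,13,14,15,16,20,28,29,30,31,35],
     [0,1,2,3,7,10,11,12,13,14,19,20,22,29,30,38],
     [0,1,2,3,12,13,14,16,17,20,21,28,29,30,31,35],
     [4,5,6,8,9,15,16,23,24,25,26,27,28,29,30,31,35],
     [4,5,8,9,18,19,22,23,24,26,27,32,33,34,36,37,40],
     [4,5,8,9,23,24,25,26,27,28,29,30,31,32,35,36,37],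
     [5,6,12,13,15,16,23,24,25,28,29,30,31,32,35,36,37],
     [5,6,15,16,17,18,21,24,25,28,31,32,33,34,35,36,37],
     [5,6,15,16,20,21,23,24,25,28,29,30,31,32,35,36,37],
     [5,6,15,17,18,20,21,23,24,25,30,31,32,33,35,36,37],
     [13,14,17,18,20,21,25,28,29,30,31,32,33,34,35,36,37],
     [15,16,17,18,20,21,25,28,29,30,31,32,33,34,35,36,37],
     [0,1,2,3,4,7,8,9,10,11,12,13,14,16,19,22,28,29,38],
     [0,1,2,3,4,7,8,9,10,11,12,13,14,19,20,22,29,30,38],
     [0,1,2,3,6,7,8,10,11,12,13,14,15,16,17,20,21,26,39],
     [0,1,2,3,6,7,10,11,12,13,14,15,16,20,28,29,30,31,35],
     [0,1,2,3,6,12,13,14,15,16,17,20,21,25,28,29,30,31,35],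
     [0,1,2,3,6,12,13,14,15,16,17,20,21,28,29,30,31,32,35],
     [0,1,2,3,7,10,11,12,13,14,16,17,20,21,28,29,30,31,35],
     [4,5,6,8,9,15,18,19,22,23,24,25,26,27,32,33,34,36,37,40],
     [4,5,6,9,15,16,17,18,21,23,24,25,28,31,32,33,34,35,36,37],
     [4,5,9,17,18,20,21,23,24,25,28,29,30,31,32,33,34,35,36,37],
     [5,6,12,13,14,15,16,20,21,23,24,25,28,29,30,31,32,35,36,37],
     [5,6,15,16,17,18,20,21,23,24,25,28,29,30,31,32,33,35,36,37],
     [5,6,15,16,17,18,20,21,24,25,28,29,30,31,32,33,34,35,36,37],
     [5,6,15,16,18,19,22,23,24,25,28,29,30,31,32,33,34,35,36,37],
     [5,6,15,17,18,19,20,21,22,23,24,25,30,31,32,33,34,35,36,37],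
     [12,13,14,15,16,17,18,20,21,25,28,29,30,31,32,33,34,35,36,37],
     [0,1,2,3,4,5,6,7,8,9,10,11,12,13,14,15,16,17,20,21,23,24],
     [0,1,2,3,4,5,6,7,8,9,10,11,12,13,14,15,16,19,22,24,25,38],
     [0,1,2,3,4,5,6,7,8,9,10,11,12,13,14,15,16,23,24,25,36,37],
     [0,1,2,3,4,5,6,12,13,14,15,16,17,20,21,24,25,28,29,30,31,35],
     [0,1,2,3,4,7,8,9,10,11,12,13,14,16,17,20,21,28,29,30,31,35],
     [0,1,2,3,4,7,8,9,10,11,12,13,14,17,18,19,20,21,22,32,33,38],
     [0,1,2,3,6,7,8,10,11,12,13,14,15,16,20,26,28,29,30,31,35,39],
     [0,1,2,3,6,7,10,11,12,13,14,15,16,17,18,19,20,21,22,33,34,38],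
     [0,1,2,3,6,7,10,11,12,13,14,15,16,17,20,21,25,28,29,30,31,35],
     [0,1,2,3,6,7,10,11,12,13,14,15,16,17,20,21,28,29,30,31,32,35],
     [0,1,2,3,6,7,10,11,12,13,14,15,16,19,20,22,28,29,30,31,35,38],
     [0,1,2,3,6,12,13,14,15,16,17,18,19,20,21,28,29,30,31,32,33,35],
     [0,1,2,3,7,10,11,12,13,14,17,18,19,20,21,22,32,33,34,36,37,38],
     [4,5,6,9,15,16,17,18,20,21,23,24,25,28,29,30,31,32,33,34,35,36,37],
     [4,5,8,9,18,19,22,23,24,25,26,27,28,29,30,31,32,33,34,35,36,37,40],
     [5,6,12,13,14,15,16,17,18,20,21,23,24,25,28,29,30,31,32,33,35,36,37],
     [5,6,12,13,14,15,16,17,18,20,21,24,25,28,29,30,31,32,33,34,35,36,37],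
     [5,6,15,16,17,18,19,20,21,22,23,24,25,28,29,30,31,32,33,34,35,36,37],
     [0,1,2,3,4,5,6,7,8,9,10,11,12,13,14,15,16,17,20,21,23,24,26,27,39],
     [0,1,2,3,4,5,6,7,8,9,10,11,12,13,14,15,16,19,22,24,25,28,29,31,38],
     [0,1,2,3,4,5,6,7,8,9,10,11,12,13,14,15,16,23,24,25,26,27,36,37,39],
     [0,1,2,3,4,5,6,7,8,9,10,11,12,13,14,15,16,23,24,25,28,29,31,36,37],
     [0,1,2,3,4,5,6,7,8,9,12,13,14,15,16,17,20,21,24,25,28,29,30,31,35],
     [0,1,2,3,4,5,6,7,10,11,12,13,14,15,16,17,20,21,24,25,28,29,30,31,35],
     [0,1,2,3,4,7,8,9,10,11,12,13,14,17,18,19,20,21,22,29,30,32,33,35,38],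
     [0,1,2,3,6,7,8,10,11,12,13,14,15,16,17,20,21,26,28,29,30,31,32,35,39],
     [0,1,2,3,6,7,10,11,12,13,14,15,16,17,18,19,20,21,28,29,30,31,32,33,35],
     [0,1,2,3,6,10,12,13,14,15,16,17,18,19,20,21,22,28,29,30,31,32,33,35,38],
     [0,1,2,3,7,10,11,12,13,14,17,18,19,20,21,22,29,30,32,33,34,35,36,37,38],
     [4,5,6,8,9,15,16,18,19,22,23,24,25,26,27,28,29,30,31,32,33,34,35,36,37,40],
     [4,5,6,9,12,13,14,15,16,17,18,20,21,23,24,25,28,29,30,31,32,33,34,35,36,37],
     [5,6,12,13,14,15,16,17,18,19,20,21,22,23,24,25,28,29,30,31,32,33,34,35,36,37],
     [0,1,2,3,4,5,6,7,8,9,10,11,12,13,14,15,16,17,20,21,23,24,25,28,29,30,31,35],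
     [0,1,2,3,4,5,6,7,8,9,10,11,12,13,14,15,16,19,20,22,24,25,28,29,30,31,35,38],
     [0,1,2,3,4,5,6,7,8,9,10,11,12,13,14,15,16,20,23,24,25,28,29,30,31,35,36,37],
     [0,1,2,3,4,5,6,7,8,9,12,13,14,15,16,17,20,21,23,24,25,26,27,28,29,30,31,35],
     [0,1,2,3,4,7,8,9,10,11,12,13,14,16,17,18,19,20,21,22,28,29,30,31,32,33,35,38],
     [0,1,2,3,6,7,8,10,11,12,13,14,15,16,17,18,19,20,21,26,28,29,30,31,32,33,35,39],
     [0,1,2,3,6,7,10,11,12,13,14,15,16,17,18,19,20,21,22,28,29,30,31,32,33,34,35,38],
     [0,1,2,3,7,10,11,12,13,14,16,17,18,19,20,21,22,28,29,30,31,32,33,34,35,36,37,38],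
     [0,1,2,4,5,6,7,8,9,12,13,14,15,16,17,20,21,23,24,25,28,29,30,31,32,35,36,37],
     [1,2,3,6,10,12,13,14,15,16,17,18,19,20,21,22,25,28,29,30,31,32,33,34,35,36,37,38],
     [1,2,4,5,6,9,12,13,14,15,16,17,18,20,21,23,24,25,28,29,30,31,32,33,34,35,36,37],
     [1,2,5,6,12,13,14,15,16,17,18,19,20,21,22,23,24,25,28,29,30,31,32,33,34,35,36,37],
     [1,2,5,6,12,13,14,15,16,17,18,20,21,23,24,25,27,28,29,30,31,32,33,34,35,36,37,40],
     [0,1,2,3,4,5,6,7,8,9,10,11,12,13,14,15,16,17,20,21,23,24,25,26,27,28,29,30,31,35,39],
     [0,1,2,3,4,5,6,7,8,9,10,11,12,13,14,15,16,17,20,21,23,24,25,28,29,30,31,32,35,36,37],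
     [0,1,2,3,4,5,6,7,8,9,10,11,12,13,14,15,16,20,23,24,25,26,27,28,29,30,31,35,36,37,39],
     [0,1,2,3,6,7,10,11,12,13,14,15,16,17,18,19,20,21,22,25,28,29,30,31,32,33,34,35,36,37,38],
     [0,1,2,4,5,6,7,8,9,12,13,14,15,16,17,18,20,21,23,24,25,28,29,30,31,32,33,34,35,36,37],
     [1,2,3,5,6,10,12,13,14,15,16,17,18,19,20,21,22,23,24,25,28,29,30,31,32,33,34,35,36,37,38],
     [0,1,2,3,4,5,6,7,8,9,10,11,12,13,14,15,16,17,18,19,20,21,22,24,25,28,29,30,31,32,33,35,37,38],
     [0,1,2,3,4,5,6,7,8,9,10,11,12,13,14,15,16,17,18,19,20,21,23,24,25,28,29,30,31,32,33,35,36,37],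
     [0,1,2,3,4,5,6,7,8,9,10,11,12,13,14,15,16,17,20,21,23,24,25,26,27,28,29,30,31,32,35,36,37,39],
     [0,1,2,3,4,5,6,7,8,9,12,13,14,15,16,17,18,19,20,21,22,23,24,25,28,29,30,31,32,33,34,35,36,37],
     [0,1,2,3,4,5,6,7,10,11,12,13,14,15,16,17,18,19,20,21,22,24,25,28,29,30,31,32,33,34,35,36,37,38],
     [0,1,2,3,4,5,6,9,10,12,13,14,15,16,17,18,19,20,21,22,23,24,25,28,29,30,31,32,33,34,35,36,37,38],
     [0,1,2,4,5,6,7,8,9,12,13,14,15,16,17,18,20,21,23,24,25,26,27,28,29,30,31,32,33,34,35,36,37,40],
     [0,1,2,3,4,5,6,7,8,9,10,11,12,13,14,15,16,17,18,19,20,21,22,23,24,25,28,29,30,31,32,33,34,35,36,37,38],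
     [0,1,2,3,4,5,6,7,8,9,10,11,12,13,14,15,16,17,18,19,20,21,23,24,25,26,27,28,29,30,31,32,33,35,36,37,39],
     [0,1,2,3,4,5,6,7,8,9,12,13,14,15,16,17,18,19,20,21,22,23,24,25,26,27,28,29,30,31,32,33,34,35,36,37,40]]"

text \<open>Of a set and its complement, which define the same cut, the one without 41 is listed; so
  each entry is a nonempty proper subset of the vertices.\<close>

lemma subtour_cuts_proper:
  "\<forall>S\<in>set subtour_cuts. S \<noteq> [] \<and> list_all (\<lambda>a. a \<le> 40) S"
  unfolding subtour_cuts_def
  by (simp only: ball_simps list.distinct zero_le_numeral one_le_numeral numeral_le_iff
      le_num_simps less_num_simps numeral_list_simps)

lemma distinct_hypo_edges: "distinct hypo_edges"
  unfolding hypo_edges_def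
  by (simp only: distinct.simps prod.inject numeral_list_simps)

text \<open>After evaluation the hypotheses form a propositional formula in 67 atoms, one per edge,
  which a SAT solver refutes.\<close>

lemma no_two_factor:
  assumes deg: "list_all (\<lambda>a. exactly_two W (incident_edges a)) [0..<42]"
    and cut: "list_all (\<lambda>S. list_ex W (crossing_edges S)) subtour_cuts"
  shows False
proof -
  note deg' = deg[unfolded upt_42 upt_41 append.simps incident_edges_def hypo_edges_def]
  note cut' = cut[unfolded crossing_edges_def subtour_cuts_def hypo_edges_def]
  show False
    using deg' cut'
    by (simp (no_asm_use) only: numeral_list_simps exactly_two_cnf cong: if_weak_cong) sat
qed

text \<open>A Hamiltonian cycle enters only as an edge predicate that is 2-regular and meets every
  cut.\<close>

lemma no_hamiltonian_cycle:
  assumes deg: "\<And>a. a \<le> 41 \<Longrightarrow> card {e \<in> set hypo_edges. W e \<and> (fst e = a \<or> snd e = a)} = 2"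
    and cut: "\<And>S. S \<subseteq> {..40} \<Longrightarrow> S \<noteq> {} \<Longrightarrow>
      \<exists>e \<in> set hypo_edges. W e \<and> (fst e \<in> S) \<noteq> (snd e \<in> S)"
  shows False
proof (rule no_two_factor)
  have "exactly_two W (incident_edges a)" if "a \<le> 41" for a
  proof -
    have "set (filter W (incident_edges a)) = {e \<in> set hypo_edges. W e \<and> (fst e = a \<or> snd e = a)}"
      by (auto simp: incident_edges_def)
    moreover have "distinct (filter W (incident_edges a))"
      by (simp add: incident_edges_def distinct_hypo_edges)
    then have "length (filter W (incident_edges a)) = card (set (filter W (incident_edges a)))"
      by (rule distinct_card[symmetric])
    ultimately show ?thesis
      using deg[OF that] by (simp only: exactly_two_def)
  qed
  then show "list_all (\<lambda>a. exactly_two W (incident_edges a)) [0..<42]"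
    by (simp add: list_all_iff)
  have "list_ex W (crossing_edges S)" if "S \<in> set subtour_cuts" for S
  proof -
    have "set S \<subseteq> {..40}" "set S \<noteq> {}"
      using that subtour_cuts_proper by (auto simp: list_all_iff)
    from cut[OF this] obtain e
      where "e \<in> set hypo_edges" "W e" "(fst e \<in> set S) \<noteq> (snd e \<in> set S)"
      by blast
    then have "e \<in> set (crossing_edges S)" "W e"
      by (simp_all add: crossing_edges_def)
    then show ?thesis
      unfolding list_ex_iff by blast
  qed
  then show "list_all (\<lambda>S. list_ex W (crossing_edges S)) subtour_cuts"
    by (simp add: list_all_iff)
qed

section \<open>Edges used by a path\<close>

definition used :: "'a list \<Rightarrow> 'a \<Rightarrow> 'a \<Rightarrow> bool" where
  "used p a b \<longleftrightarrow> (a, b) \<in> set (vwalk_arcs p) \<or> (b, a) \<in> set (vwalk_arcs p)"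

lemma used_sym: "used p a b \<longleftrightarrow> used p b a"
  by (auto simp: used_def)

lemma vwalk_arcs_members: "(a, b) \<in> set (vwalk_arcs p) \<Longrightarrow> a \<in> set p \<and> b \<in> set p"
  by (induction p rule: vwalk_arcs.induct) auto

lemma used_members: "used p a b \<Longrightarrow> a \<in> set p \<and> b \<in> set p"
  by (auto simp: used_def dest: vwalk_arcs_members)

lemma used_iff_neighbour:
  assumes "distinct (p1 @ w # p2)"
  shows "used (p1 @ w # p2) w u \<longleftrightarrow> (p1 \<noteq> [] \<and> u = last p1) \<or> (p2 \<noteq> [] \<and> u = hd p2)"
proof -
  have "set (vwalk_arcs (p1 @ w # p2)) = set (vwalk_arcs p1) \<union> set (vwalk_arcs p2)
      \<union> (if p1 = [] then {} else {(last p1, w)}) \<union> (if p2 = [] then {} else {(w, hd p2)})"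
    by (cases "p1 = []"; cases "p2 = []") (auto simp: vwalk_arcs_append)
  moreover have "(w, u) \<notin> set (vwalk_arcs p1) \<union> set (vwalk_arcs p2)"
      "(u, w) \<notin> set (vwalk_arcs p1) \<union> set (vwalk_arcs p2)"
    using assms by (auto dest: vwalk_arcs_members)
  moreover have "p1 \<noteq> [] \<Longrightarrow> last p1 \<noteq> w" "p2 \<noteq> [] \<Longrightarrow> hd p2 \<noteq> w"
    using assms by (auto dest: last_in_set hd_in_set)
  ultimately show ?thesis
    unfolding used_def by (cases "p1 = []"; cases "p2 = []") auto
qed

lemma card_used_inner:
  assumes "distinct p" "w \<in> set p" "w \<noteq> hd p" "w \<noteq> last p"
  shows "card {u. used p w u} = 2"
proof -
  obtain p1 p2 where p: "p = p1 @ w # p2"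
    using assms(2) by (meson split_list)
  have ne: "p1 \<noteq> []" "p2 \<noteq> []"
    using assms(3,4) p by auto
  have "{u. used p w u} = {last p1, hd p2}"
    using used_iff_neighbour[of p1 w p2] assms(1) ne by (auto simp: p)
  moreover have "last p1 \<noteq> hd p2"
    using assms(1) ne by (auto simp: p dest: last_in_set hd_in_set)
  ultimately show ?thesis
    by simp
qed

lemma card_used_le:
  assumes "distinct p"
  shows "finite {u. used p w u}" "card {u. used p w u} \<le> 2"
proof -
  have "\<exists>x y. {u. used p w u} \<subseteq> {x, y}"
  proof (cases "w \<in> set p")
    case True
    then obtain p1 p2 where "p = p1 @ w # p2"
      by (meson split_list)
    then show ?thesis
      using used_iff_neighbour[of p1 w p2] assms by auto
  qed (auto dest: used_members)
  then obtain x y where xy: "{u. used p w u} \<subseteq> {x, y}"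
    by blast
  then show "finite {u. used p w u}"
    by (rule finite_subset) simp
  show "card {u. used p w u} \<le> 2"
    using card_mono[OF _ xy] card_insert_le_m1[of 2 "{y}" x] by (simp add: card_insert_if split: if_splits)
qed

lemma used_crosses_cut:
  assumes "a \<in> set p" "a \<in> S" "b \<in> set p" "b \<notin> S"
  shows "\<exists>s t. s \<in> S \<and> t \<notin> S \<and> used p s t"
proof -
  \<comment> \<open>Contrapositive, by induction: if no consecutive pair changes sides, the whole
    list stays on one side.\<close>
  have "set p \<subseteq> S \<or> set p \<inter> S = {}" if "\<nexists>s t. s \<in> S \<and> t \<notin> S \<and> used p s t"
    using that
  proof (induction p rule: vwalk_arcs.induct)
    case (3 x y xs)
    have "used (x # y # xs) x y" "used (x # y # xs) y x"
      by (auto simp: used_def)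
    moreover have "used (y # xs) s t \<Longrightarrow> used (x # y # xs) s t" for s t
      by (auto simp: used_def)
    ultimately show ?case
      using 3 by fastforce
  qed auto
  then show ?thesis
    using assms by blast
qed

text \<open>The handshake lemma, by double counting. It later yields the parity of the degree at
  41.\<close>

lemma sum_degrees:
  fixes F :: "(nat \<times> nat) set"
  assumes "finite F" "\<And>e. e \<in> F \<Longrightarrow> fst e < snd e \<and> snd e < n"
  shows "(\<Sum>a<n. card {e \<in> F. fst e = a \<or> snd e = a}) = 2 * card F"
proof -
  have "(\<Sum>a<n. card {e \<in> F. fst e = a \<or> snd e = a})
      = (\<Sum>a<n. \<Sum>e\<in>F. if fst e = a \<or> snd e = a then 1 else 0)"
    using assms(1) by (intro sum.cong refl) (simp add: sum.If_cases Collect_conj_eq Int_commute)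
  also have "\<dots> = (\<Sum>e\<in>F. \<Sum>a<n. if fst e = a \<or> snd e = a then 1 else 0)"
    by (rule sum.swap)
  also have "\<dots> = (\<Sum>e\<in>F. 2)"
  proof (rule sum.cong[OF refl])
    fix e assume "e \<in> F"
    then have "{..<n} \<inter> {a. fst e = a \<or> snd e = a} = {fst e, snd e}" "fst e \<noteq> snd e"
      using assms(2)[of e] by auto
    then show "(\<Sum>a<n. if fst e = a \<or> snd e = a then 1 else 0) = (2::nat)"
      by (simp add: sum.If_cases)
  qed
  finally show ?thesis
    by simp
qed

section \<open>The glued graph\<close>

text \<open>
  Vertex \<open>a\<close> of copy \<open>i\<close>: copies 0 and 1 share the vertex 40, copies 2 and 3 share the vertex 121.
  The copy \<open>mate i\<close> shares the apex of copy \<open>i\<close>, the copy \<open>opp i\<close> is linked to its corners.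
\<close>
definition node :: "nat \<Rightarrow> nat \<Rightarrow> nat" where
  "node i a = i div 2 * 81 + (if a = 40 then 40 else a + i mod 2 * 41)"

definition mate :: "nat \<Rightarrow> nat" where
  "mate i = (if even i then i + 1 else i - 1)"

definition opp :: "nat \<Rightarrow> nat" where
  "opp i = (if i < 2 then i + 2 else i - 2)"

lemma less_4E:
  fixes i :: nat
  assumes "i < 4" obtains "i = 0" | "i = 1" | "i = 2" | "i = 3"
  using assms by linarith

text \<open>\<open>mate\<close> and \<open>opp\<close> are commuting involutions that generate a
  Klein four-group acting regularly on the copies.\<close>

lemma copy_involutions:
  assumes "i < 4"
  shows "mate i < 4" "opp i < 4" "mate (mate i) = i" "opp (opp i) = i" "mate (opp i) = opp (mate i)"
    "mate i \<noteq> i" "opp i \<noteq> i" "opp i \<noteq> mate i" "opp (mate i) \<noteq> i"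
  using assms by (auto elim!: less_4E simp: mate_def opp_def)

lemma node_less: "i < 4 \<Longrightarrow> a \<le> 40 \<Longrightarrow> node i a < 162"
  by (auto elim!: less_4E simp: node_def)

lemma node_eq_iff:
  assumes "i < 4" "j < 4" "a \<le> 40" "b \<le> 40"
  shows "node i a = node j b \<longleftrightarrow> a = b \<and> (i = j \<or> a = 40 \<and> j = mate i)"
  using assms by (elim less_4E) (auto simp: node_def mate_def split: if_splits)

lemma node_mate: "i < 4 \<Longrightarrow> node (mate i) 40 = node i 40"
  by (simp add: node_eq_iff copy_involutions)

lemma node_exhaust:
  assumes "n < 162" obtains i a where "i < 4" "a \<le> 40" "n = node i a"
proof -
  consider "n \<le> 40" | "41 \<le> n" "n \<le> 80" | "81 \<le> n" "n \<le> 121" | "122 \<le> n"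
    by linarith
  then show thesis
  proof cases
    case 1
    then show ?thesis by (intro that[of 0 n]) (auto simp: node_def)
  next
    case 2
    then show ?thesis by (intro that[of 1 "n - 41"]) (auto simp: node_def)
  next
    case 3
    then have "n - 81 \<noteq> 40 \<or> n = 121" by linarith
    with 3 show ?thesis by (intro that[of 2 "n - 81"]) (auto simp: node_def)
  next
    case 4
    with assms show ?thesis by (intro that[of 3 "n - 122"]) (auto simp: node_def)
  qed
qed

definition glued_adj :: "nat \<Rightarrow> nat \<Rightarrow> bool" where
  "glued_adj s t \<longleftrightarrow> (\<exists>i<4. (\<exists>a b. fragment_adj a b \<and> s = node i a \<and> t = node i b)
     \<or> (\<exists>a\<in>{38, 39}. s = node i a \<and> t = node (opp i) a))"

lemma glued_adj_sym: "glued_adj s t \<Longrightarrow> glued_adj t s"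
proof -
  assume "glued_adj s t"
  then consider i a b where "i < 4" "fragment_adj a b" "s = node i a" "t = node i b"
    | i a where "i < 4" "a \<in> {38, 39}" "s = node i a" "t = node (opp i) a"
    unfolding glued_adj_def by blast
  then show "glued_adj t s"
  proof cases
    case 1
    then show ?thesis
      unfolding glued_adj_def using fragment_adj_sym[of a b] by blast
  next
    case 2
    then have "opp i < 4" "s = node (opp (opp i)) a"
      by (auto simp: copy_involutions)
    with 2 show ?thesis
      unfolding glued_adj_def by blast
  qed
qed

text \<open>A vertex other than the apex belongs to exactly one copy, so only a corner link can
  leave that copy.\<close>

lemma glued_adj_inner_iff:
  assumes "i < 4" "a < 40"
  shows "glued_adj (node i a) t \<longleftrightarrow>
    (\<exists>b. fragment_adj a b \<and> t = node i b) \<or> a \<in> {38, 39} \<and> t = node (opp i) a"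
proof
  assume "glued_adj (node i a) t"
  then consider j c b where "j < 4" "fragment_adj c b" "node i a = node j c" "t = node j b"
    | j c where "j < 4" "c \<in> {38, 39}" "node i a = node j c" "t = node (opp j) c"
    unfolding glued_adj_def by blast
  then show "(\<exists>b. fragment_adj a b \<and> t = node i b) \<or> a \<in> {38, 39} \<and> t = node (opp i) a"
  proof cases
    case 1
    then show ?thesis
      using assms node_eq_iff[of i j a c] fragment_adj_range[of c b] by auto
  next
    case 2
    then have "c \<le> 40" by auto
    with 2 show ?thesis
      using assms node_eq_iff[of i j a c] by auto
  qed
qed (use assms in \<open>auto simp: glued_adj_def\<close>)

lemma glued_adj_apex_iff:
  assumes "i < 4"
  shows "glued_adj (node i 40) t \<longleftrightarrow> (\<exists>j\<in>{i, mate i}. \<exists>b. fragment_adj 40 b \<and> t = node j b)"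
proof
  assume "glued_adj (node i 40) t"
  then consider j c b where "j < 4" "fragment_adj c b" "node i 40 = node j c" "t = node j b"
    | j c where "j < 4" "c \<in> {38, 39}" "node i 40 = node j c" "t = node (opp j) c"
    unfolding glued_adj_def by blast
  then show "\<exists>j\<in>{i, mate i}. \<exists>b. fragment_adj 40 b \<and> t = node j b"
  proof cases
    case 1
    then show ?thesis
      using assms node_eq_iff[of i j 40 c] fragment_adj_range[of c b] by auto
  next
    case 2
    then have "c < 40" by auto
    with 2 show ?thesis
      using assms node_eq_iff[of i j 40 c] by auto
  qed
next
  assume "\<exists>j\<in>{i, mate i}. \<exists>b. fragment_adj 40 b \<and> t = node j b"
  then obtain j b where "j \<in> {i, mate i}" "fragment_adj 40 b" "t = node j b"
    by blast
  moreover from this have "j < 4" "node i 40 = node j 40"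
    using assms by (auto simp: copy_involutions node_mate)
  ultimately show "glued_adj (node i 40) t"
    unfolding glued_adj_def by blast
qed

section \<open>The glued graph has no Hamiltonian path\<close>

text \<open>Otherwise the part of \<open>p\<close> in copy \<open>i\<close> gives a Hamiltonian
  cycle of the 42-vertex graph: links become edges at 41, and the edge from 40 to 41 is added when
  just one path edge at the apex lies in the copy. The apex itself may be an end of
  \<open>p\<close>.\<close>

lemma apex_unused_outside:
  assumes p: "distinct p" "set p = {..<162}" "\<And>s t. used p s t \<Longrightarrow> glued_adj s t"
    and i: "i < 4"
    and inner: "\<And>a. a < 40 \<Longrightarrow> node i a \<noteq> hd p \<and> node i a \<noteq> last p"
  shows "\<not> used p (node i 40) (node i b) \<or> \<not> fragment_adj 40 b"
proof (rule ccontr)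
  assume neg: "\<not> ?thesis"
  \<comment> \<open>The edge from 40 to 41 is declared used exactly if that gives the apex degree 2.\<close>
  define D where "D = {b. fragment_adj 40 b \<and> used p (node i 40) (node i b)}"
  define W where "W e \<longleftrightarrow>
      (if e = (40, 41) then card D = 1
       else if snd e = 41 then used p (node i (fst e)) (node (opp i) (fst e))
       else used p (node i (fst e)) (node i (snd e)))" for e
  define E where "E a = {e \<in> set hypo_edges. W e \<and> (fst e = a \<or> snd e = a)}" for a
  have finE: "finite (E a)" for a
    by (simp add: E_def)
  have b: "b \<in> D"
    using neg by (simp add: D_def)
  have finD: "finite D"
    by (rule finite_subset[of _ "{..40}"]) (auto simp: D_def dest: fragment_adj_range)
  have imD: "node i ` D \<subseteq> {t. used p (node i 40) t}"
    by (auto simp: D_def)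
  have injD: "inj_on (node i) D"
    using i by (auto intro!: inj_onI simp: D_def node_eq_iff dest!: fragment_adj_range)
  have cardD: "card D \<le> 2" "card D \<noteq> 0"
    using card_mono[OF card_used_le(1)[OF p(1)] imD] card_used_le(2)[OF p(1), of "node i 40"]
      card_image[OF injD] b finD by auto
  \<comment> \<open>If \<open>D\<close> does not have one element it has two, which exhausts the
    path edges at the apex; then \<open>p\<close> cannot leave the copy there.\<close>
  have full: "t \<in> node i ` D" if "used p (node i 40) t" "card D \<noteq> 1" for t
  proof -
    have "card (node i ` D) = 2"
      using that cardD card_image[OF injD] by linarith
    then have "node i ` D = {t. used p (node i 40) t}"
      using imD card_used_le[OF p(1), of "node i 40"] by (intro card_seteq) auto
    with that show ?thesis by blast
  qed
  have inner_deg: "card (E a) = 2" if "a < 40" for a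
  proof -
    \<comment> \<open>In \<open>T\<close>, 41 stands for the linked corner. The map \<open>h\<close>
      is a bijection from the chosen edges at \<open>a\<close> onto the path neighbours of
      \<open>node i a\<close>; there are two of these because \<open>node i a\<close> is not an end
      of \<open>p\<close>.\<close>
    define T where "T c = (if c = 41 then node (opp i) a else node i c)" for c
    have T_eq: "T c = T d \<longleftrightarrow> c = d" if "c \<le> 41" "d \<le> 41" for c d
      using that \<open>a < 40\<close> i copy_involutions(7)[OF i, symmetric]
      by (auto simp: T_def node_eq_iff copy_involutions)
    define h where "h e = T (if fst e = a then snd e else fst e)" for e :: "nat \<times> nat"
    have "inj_on h (E a)"
    proof (rule inj_onI)
      fix e e' assume e: "e \<in> E a" "e' \<in> E a" "h e = h e'"
      moreover from e have "fst e < snd e \<and> snd e \<le> 41" "fst e' < snd e' \<and> snd e' \<le> 41"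
        using hypo_edges_ordered[of "fst e" "snd e"] hypo_edges_ordered[of "fst e'" "snd e'"]
        by (auto simp: E_def)
      ultimately show "e = e'"
        by (auto simp: h_def E_def T_eq prod_eq_iff split: if_splits)
    qed
    moreover have "h ` E a = {t. used p (node i a) t}"
    proof (intro equalityI subsetI)
      fix t assume "t \<in> h ` E a"
      then obtain e where e: "e \<in> E a" "t = h e" by blast
      then have ord: "fst e < snd e" "snd e \<le> 41" "(fst e, snd e) \<in> set hypo_edges"
        using hypo_edges_ordered[of "fst e" "snd e"] by (auto simp: E_def)
      show "t \<in> {t. used p (node i a) t}"
      proof (cases "fst e = a")
        case True
        with e ord \<open>a < 40\<close> show ?thesis
          by (cases e) (auto simp: E_def W_def h_def T_def split: if_splits)
      next
        case False
        with e ord \<open>a < 40\<close> show ?thesis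
          by (cases e) (auto simp: E_def W_def h_def T_def used_sym split: if_splits)
      qed
    next
      fix t assume "t \<in> {t. used p (node i a) t}"
      then have t: "used p (node i a) t" by simp
      from p(3)[OF this] consider (edge) c where "fragment_adj a c" "t = node i c"
        | (link) "a \<in> {38, 39}" "t = node (opp i) a"
        using glued_adj_inner_iff[OF i \<open>a < 40\<close>] by blast
      then show "t \<in> h ` E a"
      proof cases
        case edge
        then consider "(a, c) \<in> set hypo_edges" | "(c, a) \<in> set hypo_edges"
          by (auto simp: fragment_adj_def)
        then show ?thesis
        proof cases
          case 1
          with t edge \<open>a < 40\<close> have "(a, c) \<in> E a" "h (a, c) = t"
            using fragment_adj_range[of a c] by (auto simp: E_def W_def h_def T_def)
          then show ?thesis by blast
        next
          case 2
          with t edge \<open>a < 40\<close> have "(c, a) \<in> E a" "h (c, a) = t"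
            using fragment_adj_range[of a c] by (auto simp: E_def W_def h_def T_def used_sym)
          then show ?thesis by blast
        qed
      next
        case link
        with t have "(a, 41) \<in> E a" "h (a, 41) = t"
          using hypo_edges_41[of a] by (auto simp: E_def W_def h_def T_def)
        then show ?thesis by blast
      qed
    qed
    ultimately have "card (E a) = card {t. used p (node i a) t}"
      by (metis card_image)
    also have "\<dots> = 2"
      using card_used_inner[OF p(1), of "node i a"] p(2) inner[OF that] node_less[OF i, of a] that
      by auto
    finally show ?thesis .
  qed
  have apex_deg: "card (E 40) = 2"
  proof -
    \<comment> \<open>Apart from the edge to 41, every edge at 40 is listed as
      \<open>(c, 40)\<close>. The edge to 41 is chosen exactly if \<open>card D = 1\<close>, so the
      total is always 2.\<close>
    let ?D = "(\<lambda>b. (b, 40)) ` D" and ?V = "if card D = 1 then {(40::nat, 41::nat)} else {}"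
    have "E 40 = ?D \<union> ?V"
    proof (intro equalityI subsetI)
      fix e assume e: "e \<in> E 40"
      then have ord: "fst e < snd e" "snd e \<le> 41" "(fst e, snd e) \<in> set hypo_edges"
        using hypo_edges_ordered[of "fst e" "snd e"] by (auto simp: E_def)
      show "e \<in> ?D \<union> ?V"
      proof (cases "fst e = 40")
        case True
        with ord e show ?thesis by (cases e) (auto simp: E_def W_def)
      next
        case False
        with ord e show ?thesis
          by (cases e) (auto simp: E_def W_def D_def fragment_adj_def used_sym)
      qed
    next
      fix e :: "nat \<times> nat" assume "e \<in> ?D \<union> ?V"
      then consider c where "c \<in> D" "e = (c, 40)" | "card D = 1" "e = (40, 41)"
        by (auto split: if_splits)
      then show "e \<in> E 40"
      proof cases
        case 1
        then have "fragment_adj 40 c" by (simp add: D_def)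
        then have "c < 40" "(c, 40) \<in> set hypo_edges"
          using hypo_edges_ordered[of 40 c] by (auto simp: fragment_adj_def dest: hypo_edges_ordered)
        with 1 show ?thesis by (auto simp: E_def W_def D_def used_sym)
      next
        case 2
        then show ?thesis using hypo_edges_41[of 40] by (auto simp: E_def W_def)
      qed
    qed
    moreover have "card ?D = card D"
      by (intro card_image inj_onI) simp
    moreover have "?D \<inter> ?V = {}"
      by auto
    ultimately have "card (E 40) = card D + card ?V"
      using finD card_Un_disjoint[of ?D ?V] by simp
    with cardD show ?thesis by auto
  qed
  have cut: "\<exists>e \<in> set hypo_edges. W e \<and> (fst e \<in> S) \<noteq> (snd e \<in> S)"
    if S: "S \<subseteq> {..40}" "S \<noteq> {}" for S
  proof -
    obtain c where c: "c \<in> S" using S by blast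
    have "opp i < 4" using i by (simp add: copy_involutions)
    \<comment> \<open>Any vertex outside copy \<open>i\<close> would do here: \<open>p\<close> must
      leave the image of \<open>S\<close>. The leaving edge lies in the fragment, is a link, or
      enters the mate at the apex; the last forces \<open>card D = 1\<close>, and then the edge from
      40 to 41 crosses.\<close>
    have "node (opp i) 0 \<notin> node i ` S"
      using S i \<open>opp i < 4\<close> by (auto simp: node_eq_iff copy_involutions)
    then obtain s t where st: "s \<in> node i ` S" "t \<notin> node i ` S" "used p s t"
      using used_crosses_cut[of "node i c" p "node i ` S" "node (opp i) 0"] c S i p(2)
        node_less[OF \<open>opp i < 4\<close>, of 0] node_less[OF i, of c] by auto
    then obtain a where a: "a \<in> S" "s = node i a" by blast
    have edge: ?thesis if "fragment_adj a d" "t = node i d" for d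
    proof -
      have d: "d \<notin> S" using that st by auto
      from that have dom: "a \<le> 40" "d \<le> 40" using fragment_adj_range by auto
      from that consider "(a, d) \<in> set hypo_edges" | "(d, a) \<in> set hypo_edges"
        by (auto simp: fragment_adj_def)
      then show ?thesis
      proof cases
        case 1
        then show ?thesis
          using st a d dom that by (intro bexI[of _ "(a, d)"]) (auto simp: W_def)
      next
        case 2
        then show ?thesis
          using st a d dom that by (intro bexI[of _ "(d, a)"]) (auto simp: W_def used_sym)
      qed
    qed
    have notin: "41 \<notin> S" using S by auto
    show ?thesis
    proof (cases "a = 40")
      case False
      with a S have "a < 40" by force
      from p(3)[OF st(3)] consider d where "fragment_adj a d" "t = node i d"
        | "a \<in> {38, 39}" "t = node (opp i) a"
        using glued_adj_inner_iff[OF i \<open>a < 40\<close>] a by blast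
      then show ?thesis
      proof cases
        case 2
        then show ?thesis
          using hypo_edges_41[of a] a st notin by (intro bexI[of _ "(a, 41)"]) (auto simp: W_def)
      qed (rule edge)
    next
      case True
      show ?thesis
      proof (cases "card D = 1")
        case True
        then show ?thesis
          using hypo_edges_41[of 40] \<open>a = 40\<close> a notin by (intro bexI[of _ "(40, 41)"]) (auto simp: W_def)
      next
        case False
        then have "t \<in> node i ` D" using full st a \<open>a = 40\<close> by auto
        then show ?thesis using edge \<open>a = 40\<close> by (auto simp: D_def)
      qed
    qed
  qed
  \<comment> \<open>Vertex 41 stands for the rest of the glued graph, so its degree is not read off
    \<open>p\<close>. It is even by the handshake lemma, nonzero by the cut around 41, and at most
    3.\<close>
  have v_deg: "card (E 41) = 2"
  proof -
    let ?F = "{e \<in> set hypo_edges. W e}"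
    have "(\<Sum>a<42. card (E a)) = 2 * card ?F"
      using sum_degrees[of ?F 42] hypo_edges_ordered by (fastforce simp: E_def conj_assoc)
    moreover have "(\<Sum>a<42. card (E a)) = (\<Sum>a<40. card (E a)) + card (E 40) + card (E 41)"
      by (simp add: eval_nat_numeral lessThan_Suc)
    ultimately have "even (card (E 41))"
      using inner_deg apex_deg by (simp, presburger)
    moreover have "E 41 \<noteq> {}"
    proof -
      obtain e where "e \<in> set hypo_edges" "W e" "(fst e \<in> {..40}) \<noteq> (snd e \<in> {..40})"
        using cut[of "{..40}"] by auto
      then have "e \<in> E 41"
        using hypo_edges_ordered[of "fst e" "snd e"] by (auto simp: E_def)
      then show ?thesis by blast
    qed
    then have "card (E 41) \<noteq> 0"
      using finE by simp
    moreover have "E 41 \<subseteq> {(38, 41), (39, 41), (40, 41)}"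
      using hypo_edges_41 hypo_edges_ordered by (fastforce simp: E_def)
    then have "card (E 41) \<le> card {(38::nat, 41::nat), (39, 41), (40, 41)}"
      by (intro card_mono) auto
    then have "card (E 41) \<le> 3"
      by simp
    ultimately show ?thesis
      by presburger
  qed
  have "card (E a) = 2" if "a \<le> 41" for a
  proof -
    from that consider "a < 40" | "a = 40" | "a = 41" by linarith
    then show ?thesis using inner_deg apex_deg v_deg by cases auto
  qed
  then show False
    using no_hamiltonian_cycle[of W] cut by (auto simp: E_def)
qed

text \<open>Two copies without used apex edges disconnect the path in each of their three relative
  positions, and the two ends of the path leave two such copies.\<close>

lemma not_traceable:
  assumes p: "distinct p" "set p = {..<162}" "\<And>s t. used p s t \<Longrightarrow> glued_adj s t"
  shows False
proof -
  define K where "K i \<longleftrightarrow> (\<forall>b. fragment_adj 40 b \<longrightarrow> \<not> used p (node i 40) (node i b))" for i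
  have cut: "\<exists>s t. s \<in> S \<and> t \<notin> S \<and> used p s t" if "s \<in> S" "s < 162" "t \<notin> S" "t < 162" for S s t
    using used_crosses_cut[of s p S t] that p(2) by auto
  have inner: "(\<exists>b. fragment_adj a b \<and> t = node i b) \<or> a \<in> {38, 39} \<and> t = node (opp i) a"
    if "used p (node i a) t" "i < 4" "a < 40" for i a t
    using glued_adj_inner_iff[OF that(2,3)] p(3)[OF that(1)] by simp
  have K_sym: "\<not> used p (node i b) (node i 40)" if "K i" "fragment_adj b 40" for i b
    using that fragment_adj_sym[of b 40] used_sym[of p "node i b"] by (auto simp: K_def)
  have contra: False if i: "i < 4" and j: "j < 4" and K: "K i" "K j" and "i \<noteq> j" for i j
  proof -
    note inv = copy_involutions[OF i]
    from i j \<open>i \<noteq> j\<close> consider "j = mate i" | "j = opp i" | "j = mate (opp i)"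
      by (elim less_4E) (auto simp: mate_def opp_def)
    then show False
    proof cases
      case 1
      \<comment> \<open>Mates: their shared apex would have no used edge at all.\<close>
      have "node i 0 \<notin> {node i 40}"
        using i by (simp add: node_eq_iff)
      then obtain t where t: "used p (node i 40) t"
        using cut[of "node i 40" "{node i 40}" "node i 0"] i node_less by auto
      from p(3)[OF this] obtain k b where "k \<in> {i, mate i}" "fragment_adj 40 b" "t = node k b"
        using glued_adj_apex_iff[OF i] by auto
      with t K 1 show False
        using node_mate[OF i] by (auto simp: K_def)
    next
      case 2
      let ?S = "node i ` {..<40} \<union> node (opp i) ` {..<40}"
      have "node i 40 \<notin> ?S"
        using i inv by (auto simp: node_eq_iff)
      then obtain s t where st: "s \<in> ?S" "t \<notin> ?S" "used p s t"
        using cut[of "node i 0" ?S "node i 40"] i node_less by auto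
      then obtain k a where k: "k \<in> {i, opp i}" "a < 40" "s = node k a"
        by auto
      then have "k < 4" "K k" "opp k \<in> {i, opp i}" using i inv K 2 by auto
      from inner[of k a t] st k \<open>k < 4\<close> consider b where "fragment_adj a b" "t = node k b"
        | "t = node (opp k) a" by auto
      then show False
      proof cases
        case 1
        with st(2) k have "\<not> b < 40" by auto
        with 1 have "b = 40" using fragment_adj_range[of a b] by auto
        then show False using K_sym[OF \<open>K k\<close>, of a] 1 st k by auto
      next
        case 2
        with st(2) k \<open>opp k \<in> {i, opp i}\<close> show False by auto
      qed
    next
      case 3
      \<comment> \<open>Diagonal copies: the set could be left only from copy \<open>i\<close> to
        its apex, excluded by \<open>K i\<close>, or from the apex of \<open>opp i\<close> into its
        mate \<open>j\<close>, excluded by \<open>K j\<close>.\<close>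
      let ?S = "node i ` {..<40} \<union> node (opp i) ` {..40}"
      have "opp i < 4" "mate (opp i) < 4" using inv copy_involutions[of "opp i"] by auto
      have "node i 40 \<notin> ?S"
        using i inv by (auto simp: node_eq_iff)
      then obtain s t where st: "s \<in> ?S" "t \<notin> ?S" "used p s t"
        using cut[of "node i 0" ?S "node i 40"] i node_less by auto
      from st(1) consider (left) a where "a < 40" "s = node i a"
        | (right) a where "a < 40" "s = node (opp i) a" | (apex) "s = node (opp i) 40"
        by (auto simp: le_less)
      then show False
      proof cases
        case left
        from inner[of i a t] st left i consider b where "fragment_adj a b" "t = node i b"
          | "t = node (opp i) a" by auto
        then show False
        proof cases
          case 1
          with st(2) have "\<not> b < 40" by auto
          with 1 have "b = 40" using fragment_adj_range[of a b] by auto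
          then show False using K_sym[OF K(1), of a] 1 st left by auto
        qed (use st left in auto)
      next
        case right
        from inner[of "opp i" a t] st right \<open>opp i < 4\<close> consider b where "fragment_adj a b" "t = node (opp i) b"
          | "t = node i a" using inv by auto
        then show False
        proof cases
          case 1
          with st(2) show False using fragment_adj_range[of a b] by auto
        qed (use st right in auto)
      next
        case apex
        from p(3)[OF st(3)] apex obtain k b where k: "k \<in> {opp i, mate (opp i)}" "fragment_adj 40 b" "t = node k b"
          using glued_adj_apex_iff[OF \<open>opp i < 4\<close>] by auto
        show False
        proof (cases "k = opp i")
          case True
          with k st(2) show False using fragment_adj_range[of 40 b] by auto
        next
          case False
          with k have "used p (node (mate (opp i)) 40) (node (mate (opp i)) b)"
            using apex st(3) node_mate[OF \<open>opp i < 4\<close>] by auto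
          with K(2) 3 k show False by (auto simp: K_def)
        qed
      qed
    qed
  qed
  define L where "L i \<longleftrightarrow> (\<forall>a<40. node i a \<noteq> hd p \<and> node i a \<noteq> last p)" for i
  have LK: "K i" if "i < 4" "L i" for i
    unfolding K_def using apex_unused_outside[OF p \<open>i < 4\<close>] that(2) by (auto simp: L_def)
  have one_end: "i = j" if "i < 4" "j < 4" "a < 40" "b < 40" "node i a = w" "node j b = w" for i j a b w
    using that node_eq_iff[of i j a b] by auto
  have "\<exists>i j. i < 4 \<and> j < 4 \<and> i \<noteq> j \<and> L i \<and> L j"
  proof -
    \<comment> \<open>Each end of the path is an inner vertex of at most one copy \<open>h\<close>;
      if it is an apex, any \<open>h\<close> serves.\<close>
    have "\<exists>h. \<forall>i<4. i \<noteq> h \<longrightarrow> (\<forall>a<40. node i a \<noteq> w)" for w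
      using one_end[where w = w] by (metis (no_types, lifting))
    then obtain h l where "\<forall>i<4. i \<noteq> h \<longrightarrow> (\<forall>a<40. node i a \<noteq> hd p)"
        and "\<forall>i<4. i \<noteq> l \<longrightarrow> (\<forall>a<40. node i a \<noteq> last p)"
      by meson
    then have "L i" if "i < 4" "i \<noteq> h" "i \<noteq> l" for i
      using that by (auto simp: L_def)
    moreover have "\<exists>i\<in>{0, 1, 2, 3}. \<exists>j\<in>{0, 1, 2, 3}. i \<noteq> j \<and> i \<noteq> h \<and> i \<noteq> l \<and> j \<noteq> h \<and> j \<noteq> l"
      by (cases "h = 0"; cases "h = 1"; cases "h = 2"; cases "l = 0"; cases "l = 1"; cases "l = 2") auto
    then obtain i j where "i \<in> {0, 1, 2, 3}" "j \<in> {0, 1, 2, 3}"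
      "i \<noteq> j" "i \<noteq> h" "i \<noteq> l" "j \<noteq> h" "j \<noteq> l"
      by blast
    moreover from this have "i < 4" "j < 4"
      by auto
    ultimately show ?thesis by blast
  qed
  then show False
    using contra LK by blast
qed

section \<open>Hamiltonian paths after deleting a vertex\<close>

text \<open>Unfolding the edge list turns this into ground facts in both directions, by which
  simplification checks the explicit paths.\<close>

lemma hypo_edges_fragment_adj: "list_all (\<lambda>e. snd e \<noteq> 41 \<longrightarrow> fragment_adj (fst e) (snd e) \<and> fragment_adj (snd e) (fst e)) hypo_edges"
proof -
  have "fst e \<noteq> 41" if "e \<in> set hypo_edges" for e
    using hypo_edges_ordered[of "fst e" "snd e"] that by auto
  then show ?thesis
    by (auto simp: list_all_iff fragment_adj_def)
qed

lemmas fragment_adj_facts = hypo_edges_fragment_adj[unfolded hypo_edges_def, simplified numeral_list_simps]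

text \<open>
  The first two paths together span the fragment: the first one joins the apex to the corner 39,
  the second one starts at the corner 38. The next two are Hamiltonian paths of the fragment.
\<close>
definition apex_corner_path :: "nat list" where
  "apex_corner_path =
    [40, 34, 36, 37, 25, 15, 6, 1, 0, 3, 10, 11, 7, 8, 9, 4, 5, 24, 23, 27, 26, 39]"

definition corner_path :: "nat list" where
  "corner_path =
    [38, 22, 19, 18, 33, 32, 35, 31, 28, 16, 12, 13, 14, 2, 17, 21, 20, 30, 29]"

definition left_path :: "nat list" where
  "left_path =
    [38, 10, 3, 2, 17, 21, 20, 14, 13, 12, 16, 28, 29, 30, 35, 31, 25, 15, 6, 1, 0, 4, 5, 24,
     23, 9, 8, 7, 11, 39, 26, 27, 40, 34, 36, 37, 32, 33, 18, 19, 22]"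

definition right_path :: "nat list" where
  "right_path =
    [39, 26, 8, 9, 4, 5, 24, 23, 27, 40, 34, 36, 37, 32, 33, 18, 17, 21, 20, 14, 13, 12, 16,
     28, 29, 30, 35, 31, 25, 15, 6, 1, 2, 3, 19, 22, 38, 10, 11, 7, 0]"

text \<open>Each entry \<open>(a, q)\<close> is a Hamiltonian path \<open>q\<close> of the fragment without \<open>a\<close>.\<close>
definition deleted_paths :: "(nat \<times> nat list) list" where
  "deleted_paths =
    [(0, [39,26,8,7,11,10,38,22,19,3,2,14,13,29,30,20,21,17,18,33,34,36,37,32,35,31,28,16,12,1,6,15,25,24,5,4,9,23,27,40]),
     (1, [39,11,10,38,22,19,3,2,14,20,30,29,13,12,16,28,31,35,32,21,17,18,33,34,36,37,25,15,6,5,24,23,9,4,0,7,8,26,27,40]),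
     (2, [39,26,8,7,11,10,38,22,19,3,0,1,6,15,16,12,13,14,20,30,29,28,31,35,32,21,17,18,33,34,36,37,25,24,5,4,9,23,27,40]),
     (3, [39,11,10,38,22,19,18,33,32,21,17,2,14,20,30,35,31,28,29,13,12,16,15,6,1,0,7,8,26,27,23,9,4,5,24,25,37,36,34,40]),
     (4, [39,11,7,0,3,10,38,22,19,18,33,34,36,37,25,31,28,29,13,14,20,30,35,32,21,17,2,1,12,16,15,6,5,24,23,9,8,26,27,40]),
     (5, [38,10,3,2,17,21,20,14,13,12,1,6,15,16,28,29,30,35,31,25,24,23,36,37,32,33,18,19,22,34,40,27,26,8,9,4,0,7,11,39]),
     (6, [39,11,7,0,4,5,24,25,15,16,12,1,2,14,13,29,28,31,35,30,20,21,17,18,19,3,10,38,22,34,33,32,37,36,23,9,8,26,27,40]),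
     (7, [38,22,34,40,27,26,8,9,23,36,37,25,24,5,4,0,1,6,15,16,12,13,14,2,17,21,20,30,29,28,31,35,32,33,18,19,3,10,11,39]),
     (8, [38,10,11,7,0,3,2,17,21,20,14,13,29,30,35,31,28,16,12,1,6,15,25,24,5,4,9,23,36,37,32,33,18,19,22,34,40,27,26,39]),
     (9, [38,10,3,2,17,21,20,14,13,29,30,35,31,28,16,12,1,0,4,5,6,15,25,24,23,36,37,32,33,18,19,22,34,40,27,26,8,7,11,39]),
     (10, [38,22,19,3,2,1,0,4,5,6,15,16,12,13,14,20,21,17,18,33,34,36,37,32,35,30,29,28,31,25,24,23,9,8,7,11,39,26,27,40]),
     (11, [38,10,3,2,17,21,20,14,13,12,16,15,6,1,0,7,8,9,4,5,24,23,36,37,25,31,28,29,30,35,32,33,18,19,22,34,40,27,26,39]),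
     (12, [38,22,34,33,32,21,20,30,35,31,25,37,36,23,24,5,4,9,8,7,0,1,6,15,16,28,29,13,14,2,17,18,19,3,10,11,39,26,27,40]),
     (13, [39,11,10,38,22,19,3,2,14,20,21,17,18,33,34,36,37,32,35,30,29,28,31,25,15,16,12,1,6,5,24,23,9,4,0,7,8,26,27,40]),
     (14, [38,10,11,7,8,9,4,5,6,1,0,3,2,17,21,20,30,35,31,28,29,13,12,16,15,25,24,23,36,37,32,33,18,19,22,34,40,27,26,39]),
     (15, [39,11,10,38,22,19,3,2,14,13,12,16,28,29,30,20,21,17,18,33,34,36,37,32,35,31,25,24,23,9,4,5,6,1,0,7,8,26,27,40]),
     (16, [39,26,8,9,4,0,7,11,10,38,22,19,3,2,1,12,13,14,20,21,17,18,33,34,36,37,32,35,30,29,28,31,25,15,6,5,24,23,27,40]),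
     (17, [39,11,7,0,3,10,38,22,19,18,33,32,21,20,14,2,1,12,13,29,30,35,31,28,16,15,6,5,4,9,8,26,27,23,24,25,37,36,34,40]),
     (18, [38,10,3,19,22,34,33,32,35,31,28,29,30,20,21,17,2,14,13,12,16,15,6,1,0,4,5,24,25,37,36,23,9,8,7,11,39,26,27,40]),
     (19, [38,22,34,33,18,17,21,20,30,29,28,16,12,13,14,2,1,6,15,25,31,35,32,37,36,23,24,5,4,9,8,7,0,3,10,11,39,26,27,40]),
     (20, [38,22,19,3,10,11,7,8,9,4,0,1,2,14,13,12,16,28,29,30,35,31,25,15,6,5,24,23,36,37,32,21,17,18,33,34,40,27,26,39]),
     (21, [39,11,10,38,22,19,3,2,17,18,33,34,36,23,9,4,5,24,25,37,32,35,31,28,29,30,20,14,13,12,16,15,6,1,0,7,8,26,27,40]),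
     (22, [38,10,11,7,8,9,4,0,1,2,3,19,18,17,21,20,14,13,12,16,28,29,30,35,31,25,15,6,5,24,23,36,37,32,33,34,40,27,26,39]),
     (23, [39,11,7,0,1,6,15,16,12,13,14,2,3,10,38,22,19,18,17,21,20,30,29,28,31,35,32,33,34,36,37,25,24,5,4,9,8,26,27,40]),
     (24, [38,10,3,19,22,34,33,18,17,21,20,14,2,1,0,7,11,39,26,8,9,4,5,6,15,25,31,28,16,12,13,29,30,35,32,37,36,23,27,40]),
     (25, [38,10,3,19,22,34,33,18,17,21,32,37,36,23,24,5,6,15,16,12,13,29,28,31,35,30,20,14,2,1,0,4,9,8,7,11,39,26,27,40]),
     (26, [38,10,3,0,1,6,15,16,12,13,14,2,17,21,20,30,29,28,31,35,32,33,18,19,22,34,40,27,23,36,37,25,24,5,4,9,8,7,11,39]),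
     (27, [39,26,8,7,11,10,38,22,19,3,2,1,0,4,9,23,36,37,32,35,30,29,28,31,25,24,5,6,15,16,12,13,14,20,21,17,18,33,34,40]),
     (28, [38,22,34,33,32,37,36,23,24,25,31,35,30,29,13,12,16,15,6,5,4,9,8,7,0,1,2,14,20,21,17,18,19,3,10,11,39,26,27,40]),
     (29, [38,10,3,19,22,34,36,37,32,33,18,17,21,20,30,35,31,28,16,12,13,14,2,1,0,7,11,39,26,8,9,4,5,6,15,25,24,23,27,40]),
     (30, [38,10,3,2,14,20,21,17,18,19,22,34,33,32,35,31,28,29,13,12,16,15,6,1,0,7,11,39,26,8,9,4,5,24,25,37,36,23,27,40]),
     (31, [38,22,19,18,33,34,40,27,23,36,37,32,35,30,29,28,16,12,13,14,20,21,17,2,3,10,11,7,0,1,6,15,25,24,5,4,9,8,26,39]),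
     (32, [39,26,8,9,4,0,7,11,10,38,22,19,3,2,1,12,16,28,31,35,30,29,13,14,20,21,17,18,33,34,36,37,25,15,6,5,24,23,27,40]),
     (33, [38,10,3,2,14,13,12,16,15,6,1,0,4,5,24,25,37,32,35,31,28,29,30,20,21,17,18,19,22,34,36,23,9,8,7,11,39,26,27,40]),
     (34, [39,11,7,0,1,6,15,25,31,35,30,29,28,16,12,13,14,20,21,17,2,3,10,38,22,19,18,33,32,37,36,23,24,5,4,9,8,26,27,40]),
     (35, [39,11,7,0,1,6,15,16,12,13,14,2,3,10,38,22,19,18,17,21,20,30,29,28,31,25,24,5,4,9,8,26,27,23,36,37,32,33,34,40]),
     (36, [38,10,11,39,26,8,7,0,1,6,15,16,12,13,14,2,3,19,22,34,33,18,17,21,20,30,29,28,31,35,32,37,25,24,5,4,9,23,27,40]),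
     (37, [38,22,19,18,17,2,1,6,15,25,31,35,30,29,28,16,12,13,14,20,21,32,33,34,36,23,24,5,4,9,8,7,0,3,10,11,39,26,27,40]),
     (38, [39,26,8,7,11,10,3,0,1,6,15,16,12,13,14,2,17,21,20,30,29,28,31,35,32,33,18,19,22,34,36,37,25,24,5,4,9,23,27,40]),
     (39, [38,22,19,18,33,34,36,37,32,35,30,29,28,31,25,24,23,9,4,5,6,15,16,12,13,14,20,21,17,2,1,0,3,10,11,7,8,26,27,40]),
     (40, [38,22,34,33,32,21,20,30,35,31,28,29,13,14,2,17,18,19,3,10,11,7,8,9,4,0,1,12,16,15,6,5,24,25,37,36,23,27,26,39])]"

text \<open>Membership tests over a fixed range make this decidable by simplification, without set
  equalities.\<close>

definition spans :: "nat list \<Rightarrow> (nat \<Rightarrow> bool) \<Rightarrow> bool" where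
  "spans q P \<longleftrightarrow> list_all (\<lambda>b. b \<le> 40) q \<and>
     list_all (\<lambda>b. (b \<in> set q) = P b) [0..<41] \<and> distinct q"

lemma spansD:
  assumes "spans q P"
  shows "set q = {b. b \<le> 40 \<and> P b}" "distinct q"
  using assms by (fastforce simp: spans_def list_all_iff)+

lemmas path_simps = numeral_list_simps successively.simps fragment_adj_facts list.sel last.simps list.distinct
  zero_le_numeral one_le_numeral numeral_le_iff le_num_simps less_num_simps le0 prod.inject
  case_prod_conv distinct.simps upt_41

lemma deleted_paths_range: "map fst deleted_paths = [0..<41]"
  unfolding deleted_paths_def upt_41 by (simp only: list.map fst_conv)

text \<open>The prescribed ends are neighbours of 41: each path is a Hamiltonian cycle of the
  42-vertex graph without \<open>a\<close>, opened at 41.\<close>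

lemma deleted_paths_correct:
  "list_all (\<lambda>(a, q). successively fragment_adj q \<and> spans q (\<lambda>b. b \<noteq> a)
     \<and> (hd q, last q) \<in> {(38, 39), (38, 40), (39, 40)}) deleted_paths"
  unfolding deleted_paths_def spans_def
  by (simp only: path_simps cong: if_weak_cong)

lemma fixed_paths_correct:
  "successively fragment_adj apex_corner_path" "hd apex_corner_path = 40" "last apex_corner_path = 39"
  "successively fragment_adj corner_path" "hd corner_path = 38"
  "successively fragment_adj left_path" "hd left_path = 38" "spans left_path (\<lambda>b. True)"
  "successively fragment_adj right_path" "hd right_path = 39" "spans right_path (\<lambda>b. True)"
  "spans (apex_corner_path @ corner_path) (\<lambda>b. True)"
  "tl apex_corner_path \<noteq> []" "corner_path \<noteq> []"
  unfolding apex_corner_path_def corner_path_def left_path_def right_path_def spans_def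
  by (simp_all only: path_simps append.simps cong: if_weak_cong)

section \<open>Joining paths across the copies\<close>

lemma successively_node:
  assumes "successively fragment_adj q" "i < 4"
  shows "successively glued_adj (map (node i) q)" "successively glued_adj (map (node i) (rev q))"
proof -
  have 1: "glued_adj (node i a) (node i b)" "glued_adj (node i b) (node i a)" if "fragment_adj a b" for a b
    using that assms(2) fragment_adj_sym[of a b] unfolding glued_adj_def by blast+
  show "successively glued_adj (map (node i) q)" "successively glued_adj (map (node i) (rev q))"
    unfolding successively_map successively_rev
    using assms(1) 1 by (auto elim!: successively_mono)
qed

lemma glued_adj_link: "i < 4 \<Longrightarrow> a \<in> {38, 39} \<Longrightarrow> glued_adj (node i a) (node (opp i) a)"
  unfolding glued_adj_def by blast

lemma successively_append_link:
  assumes "successively P xs" "successively P ys" "xs \<noteq> []" "ys \<noteq> []" "P (last xs) (hd ys)"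
  shows "successively P (xs @ ys)"
  using assms by (simp add: successively_append_iff)

text \<open>The path of the fragment without \<open>a\<close> is placed in copy \<open>i\<close>.
  Its extension depends on whether it joins the two corners or a corner and the apex; the pair
  \<open>apex_corner_path\<close>, \<open>corner_path\<close> allows a copy to be covered in two
  visits.\<close>

lemma deleted_traceable:
  assumes i: "i < 4" and a: "a \<le> 40"
  shows "\<exists>p. successively glued_adj p \<and> distinct p \<and> set p = {..<162} - {node i a}"
proof -
  note inv = copy_involutions[OF i]
  define m o' om where "m = mate i" and "o' = opp i" and "om = mate (opp i)"
  have copies: "m < 4" "o' < 4" "om < 4"
    and distinct_copies: "m \<noteq> i" "o' \<noteq> i" "om \<noteq> i" "o' \<noteq> m" "om \<noteq> m" "om \<noteq> o'"
    and links: "opp i = o'" "opp o' = i" "opp m = om" "opp om = m"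
    and mates: "mate i = m" "mate m = i" "mate o' = om" "mate om = o'"
    using i by (auto simp: m_def o'_def om_def mate_def opp_def elim!: less_4E)
  have every_copy: "j = i \<or> j = m \<or> j = o' \<or> j = om" if "j < 4" for j
    using that i by (auto simp: m_def o'_def om_def mate_def opp_def elim!: less_4E)
  have apex: "node m 40 = node i 40" "node om 40 = node o' 40"
    using node_mate[OF i] node_mate[OF copies(2)] mates by auto
  let ?A = apex_corner_path and ?B = corner_path
  have path_of: "\<exists>q. (b, q) \<in> set deleted_paths" if "b \<le> 40" for b
  proof -
    have "b \<in> set (map fst deleted_paths)"
      unfolding deleted_paths_range using that by simp
    then show ?thesis by force
  qed
  have pathD: "successively fragment_adj q" "set q = {b. b \<le> 40 \<and> b \<noteq> c}" "distinct q"
      "(hd q, last q) \<in> {(38, 39), (38, 40), (39, 40)}" if "(c, q) \<in> set deleted_paths" for c q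
    using that deleted_paths_correct spansD[of q "\<lambda>b. b \<noteq> c"] by (auto simp: list_all_iff)
  obtain q where q: "(a, q) \<in> set deleted_paths" using path_of[OF a] by blast
  obtain d where d: "(40, d) \<in> set deleted_paths" using path_of[of 40] by blast
  \<comment> \<open>\<open>d\<close> omits 40, so both its ends are corners.\<close>
  have "hd d = 38 \<and> last d = 39"
    using pathD(2,4)[OF d] last_in_set[of d] hd_in_set[of d] by (cases "d = []") auto
  have "0 \<in> set q \<or> 1 \<in> set q" "0 \<in> set d"
    unfolding pathD(2)[OF q] pathD(2)[OF d] by auto
  then have nonempty: "q \<noteq> []" "d \<noteq> []"
    by auto
  have split: "set ?A \<union> set ?B = {..40}" "set ?A \<inter> set ?B = {}" "distinct ?A" "distinct ?B"
    using spansD[OF fixed_paths_correct(12)] by (simp_all add: atMost_def)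
  have whole: "set left_path = {..40}" "distinct left_path" "set right_path = {..40}" "distinct right_path"
    using spansD[OF fixed_paths_correct(8)] spansD[OF fixed_paths_correct(11)]
    by (simp_all add: atMost_def)
  \<comment> \<open>Mated copies share their apex: after it has been visited in one copy, the path
    continues in the other from the next vertex.\<close>
  define A' where "A' = tl ?A"
  have A': "?A = 40 # A'" "A' \<noteq> []"
    using fixed_paths_correct(2,13) unfolding A'_def by (metis list.collapse list.sel(2))+
  have A'_path: "successively fragment_adj A'" "fragment_adj 40 (hd A')" "last A' = 39" "40 \<notin> set A'" "distinct A'"
    using fixed_paths_correct(1,3)[unfolded A'(1)] split(3)[unfolded A'(1)] A'(2)
    by (simp_all add: successively_Cons)
  have A'_B: "set A' \<union> set ?B = {..<40}" "set A' \<inter> set ?B = {}"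
  proof -
    have "40 \<notin> set ?B" "set A' \<inter> set ?B = {}"
      using split(2)[unfolded A'(1)] by auto
    moreover have "insert 40 (set A' \<union> set ?B) = {..40}"
      using split(1)[unfolded A'(1)] by simp
    ultimately have "set A' \<union> set ?B = {..40} - {40}"
      using A'_path(4) by blast
    then show "set A' \<union> set ?B = {..<40}" "set A' \<inter> set ?B = {}"
      using \<open>set A' \<inter> set ?B = {}\<close> by auto
  qed
  have len: "length A' + length ?B = 40" "length q = 40" "length d = 40"
    "length left_path = 41" "length right_path = 41"
  proof -
    have "{b. b \<le> 40 \<and> b \<noteq> c} = {..40} - {c}" for c :: nat
      by auto
    then show "length q = 40" "length d = 40"
      using pathD(2,3)[OF q] pathD(2,3)[OF d] a by (simp_all flip: distinct_card)
    show "length left_path = 41" "length right_path = 41"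
      using whole by (simp_all flip: distinct_card)
    show "length A' + length ?B = 40"
      using A'_B A'_path(5) split(4) card_Un_disjoint[of "set A'" "set ?B"]
      by (simp flip: distinct_card)
  qed
  have dset: "set d = {..<40}"
    using pathD(2)[OF d] by (auto simp: le_less)
  have node_other: "node j b \<noteq> node i a" if "j < 4" "b \<le> 40" "b < 40 \<and> j \<noteq> i \<or> j \<noteq> i \<and> j \<noteq> m \<or> j = i \<and> b \<noteq> a" for j b
    using that node_eq_iff[of i j a b] i a mates by (auto dest!: sym[of "node j b"])
  \<comment> \<open>Distinctness comes from counting: 161 entries with 161 different values. The
    apexes of \<open>m\<close> and \<open>om\<close> need no coverage of their own, being those of
    \<open>i\<close> and \<open>o'\<close>.\<close>
  have spanning: ?thesis
    if path: "successively glued_adj p" and length_p: "length p = 161"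
      and sub: "set p \<subseteq> {..<162} - {node i a}"
      and cover: "\<And>b. b \<le> 40 \<Longrightarrow> b \<noteq> a \<Longrightarrow> node i b \<in> set p"
      "\<And>b. b < 40 \<Longrightarrow> node m b \<in> set p" "\<And>b. b \<le> 40 \<Longrightarrow> node o' b \<in> set p"
      "\<And>b. b < 40 \<Longrightarrow> node om b \<in> set p" for p
  proof -
    have "n \<in> set p" if n: "n < 162" "n \<noteq> node i a" for n
    proof -
      obtain j b where jb: "j < 4" "b \<le> 40" "n = node j b"
        by (rule node_exhaust[OF n(1)])
      consider "j = i" | "j \<noteq> i" "b = 40" | "j \<noteq> i" "b < 40"
        using jb by linarith
      then show ?thesis
      proof cases
        case 1
        then show ?thesis using cover(1)[of b] jb n(2) by blast
      next
        case 2
        then have "n = node i 40 \<or> n = node o' 40"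
          using every_copy[OF jb(1)] jb apex by auto
        then show ?thesis using cover(1,3)[of 40] n(2) by auto
      next
        case 3
        then show ?thesis
          using every_copy[OF jb(1)] cover(2,4)[of b] cover(3)[OF jb(2)] jb(3) by auto
      qed
    qed
    then have "{..<162} - {node i a} \<subseteq> set p" by blast
    with sub have set_p: "set p = {..<162} - {node i a}" by (rule equalityI)
    moreover have "card (set p) = length p"
      using length_p node_less[OF i a] by (simp add: set_p)
    then have "distinct p" by (rule card_distinct)
    ultimately show ?thesis
      using path by blast
  qed
  have qset: "set q = {b. b \<le> 40 \<and> b \<noteq> a}"
    by (rule pathD(2)[OF q])
  have hd_last: "hd q = 38 \<and> last q = 39 \<or> hd q \<in> {38, 39} \<and> last q = 40"
    using pathD(4)[OF q] by auto
  note segments = successively_node[OF pathD(1)[OF q] i]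
    successively_node[OF pathD(1)[OF d] copies(1)] successively_node[OF pathD(1)[OF d] copies(3)]
    successively_node[OF A'_path(1) copies(1)] successively_node[OF A'_path(1) copies(3)]
    successively_node[OF A'_path(1) copies(2)] successively_node[OF fixed_paths_correct(1) copies(3)]
    successively_node[OF fixed_paths_correct(1) copies(2)]
    successively_node[OF fixed_paths_correct(4) copies(1)] successively_node[OF fixed_paths_correct(4) copies(2)]
    successively_node[OF fixed_paths_correct(4) copies(3)]
    successively_node[OF fixed_paths_correct(6) copies(2)] successively_node[OF fixed_paths_correct(9) copies(2)]
  have link: "glued_adj (node i b) (node o' b)" "glued_adj (node o' b) (node i b)"
      "glued_adj (node m b) (node om b)" "glued_adj (node om b) (node m b)" if "b \<in> {38, 39}" for b
    using glued_adj_link[OF i that] glued_adj_link[OF copies(1) that] glued_adj_link[OF copies(2) that]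
      glued_adj_link[OF copies(3) that] unfolding links by auto
  have apex_edge: "glued_adj (node j 40) (node j (hd A'))" if "j < 4" for j
    using A'_path(2) that unfolding glued_adj_def by blast
  have hd_last_d: "hd d = 38" "last d = 39"
    using \<open>hd d = 38 \<and> last d = 39\<close> by auto
  have in_A'_B: "b \<in> set A' \<or> b \<in> set ?B" if "b < 40" for b
    using A'_B(1) that by blast
  have range: "b \<in> set A' \<Longrightarrow> b < 40" "b \<in> set ?B \<Longrightarrow> b < 40" "b \<in> set q \<Longrightarrow> b \<le> 40 \<and> b \<noteq> a" for b
    using A'_B(1) qset by auto
  have A_facts: "?A \<noteq> []" "hd ?A = 40" "length ?A = Suc (length A')" "set ?A \<subseteq> {..40}" "set ?B \<subseteq> {..40}"
    subgoal using A'(1) by auto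
    subgoal by (rule fixed_paths_correct(2))
    subgoal by (subst A'(1)) simp
    using split(1) by auto
  have inside: "node i ` X \<subseteq> {..<162} - {node i a}" if "X \<subseteq> {..40} - {a}" for X
    using that node_less[OF i] node_other[OF i] by fastforce
  have inside': "node j ` X \<subseteq> {..<162} - {node i a}" if "X \<subseteq> {..<40}" "j \<in> {m, om}" for X j
  proof -
    have "j < 4" "j \<noteq> i" using that(2) copies distinct_copies by auto
    then show ?thesis
      using that(1) node_less[of j] node_other[of j] by fastforce
  qed
  note inside_m = inside'[of _ m, simplified] and inside_om = inside'[of _ om, simplified]
  have inside'': "node o' ` X \<subseteq> {..<162} - {node i a}" if "X \<subseteq> {..40}" for X
    using that node_less[OF copies(2)] node_other[OF copies(2)] distinct_copies by fastforce
  have qset': "set q \<subseteq> {..40} - {a}"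
    using qset by auto
  consider "hd q = 38" "last q = 39" | "hd q \<in> {38, 39}" "last q = 40"
    using hd_last by blast
  then show ?thesis
  proof cases
    case 1
    \<comment> \<open>Route: part of \<open>o'\<close> to corner 38, copy \<open>i\<close> from 38
      to 39, the rest of \<open>o'\<close> from 39 to its apex, \<open>om\<close> from that apex to
      39, \<open>m\<close> without its apex from 39 to 38, the rest of \<open>om\<close>. The apex
      of \<open>m\<close> is that of \<open>i\<close>, hence visited by \<open>q\<close> or
      deleted.\<close>
    let ?p = "map (node o') (rev ?B) @ map (node i) q @ map (node o') (rev ?A) @ map (node om) A'
      @ map (node m) (rev d) @ map (node om) ?B"
    show ?thesis
    proof (rule spanning[of ?p])
      show "successively glued_adj ?p"
      proof -
        have "glued_adj (node o' 38) (node i 38)" "glued_adj (node i 39) (node o' 39)"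
          "glued_adj (node o' 40) (node om (hd A'))" "glued_adj (node om 39) (node m 39)"
          "glued_adj (node m 38) (node om 38)"
          using link[of 38] link[of 39] apex_edge[OF copies(3)] apex(2) by auto
        with nonempty A'(2) A_facts(1,2) 1 hd_last_d fixed_paths_correct(3,5,14) A'_path(3)
        show ?thesis
          by (intro successively_append_link segments) (simp_all add: last_map hd_map hd_rev last_rev)
      qed
      show "length ?p = 161"
        using len A_facts(3) by simp
      show "set ?p \<subseteq> {..<162} - {node i a}"
        unfolding set_append set_map set_rev using A_facts(4,5) qset' range dset
        by (intro Un_least inside inside_m inside_om inside'') auto
    next
      fix b :: nat
      show "b \<le> 40 \<Longrightarrow> b \<noteq> a \<Longrightarrow> node i b \<in> set ?p" using qset by simp
      show "b < 40 \<Longrightarrow> node m b \<in> set ?p" using dset by simp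
      show "b \<le> 40 \<Longrightarrow> node o' b \<in> set ?p" using split(1) by auto
      show "b < 40 \<Longrightarrow> node om b \<in> set ?p" using in_A'_B[of b] by auto
    qed
  next
    case 2
    \<comment> \<open>\<open>s\<close> starts at the same corner as \<open>q\<close>, so its
      reversal in \<open>o'\<close> ends at the link to copy \<open>i\<close>.\<close>
    define s where "s = (if hd q = 38 then left_path else right_path)"
    have s: "hd s = hd q" "set s = {..40}" "length s = 41" "s \<noteq> []"
        "successively glued_adj (map (node o') (rev s))"
      using 2 whole len segments fixed_paths_correct(7,10) by (auto simp: s_def)
    \<comment> \<open>Route: all of \<open>o'\<close>, copy \<open>i\<close> from a corner to its
      apex, \<open>m\<close> from that apex to 39, \<open>om\<close> without its apex from 39 to 38,
      the rest of \<open>m\<close>. The apex of \<open>om\<close> was visited in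
      \<open>o'\<close>.\<close>
    let ?p = "map (node o') (rev s) @ map (node i) q @ map (node m) A' @ map (node om) (rev d) @ map (node m) ?B"
    show ?thesis
    proof (rule spanning[of ?p])
      show "successively glued_adj ?p"
      proof -
        have "glued_adj (node o' (hd q)) (node i (hd q))" "glued_adj (node i 40) (node m (hd A'))"
          "glued_adj (node m 39) (node om 39)" "glued_adj (node om 38) (node m 38)"
          using link[of 38] link[of 39] apex_edge[OF copies(1)] apex(1) 2(1) by auto
        with nonempty A'(2) 2 hd_last_d s(1,4) fixed_paths_correct(5,14) A'_path(3)
        show ?thesis
          by (intro successively_append_link segments s(5)) (simp_all add: last_map hd_map hd_rev last_rev)
      qed
      show "length ?p = 161"
        using len s(3) by simp
      show "set ?p \<subseteq> {..<162} - {node i a}"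
        unfolding set_append set_map set_rev using s(2) qset' range dset
        by (intro Un_least inside inside_m inside_om inside'') auto
    next
      fix b :: nat
      show "b \<le> 40 \<Longrightarrow> b \<noteq> a \<Longrightarrow> node i b \<in> set ?p" using qset by simp
      show "b < 40 \<Longrightarrow> node m b \<in> set ?p" using in_A'_B[of b] by auto
      show "b \<le> 40 \<Longrightarrow> node o' b \<in> set ?p" using s(2) by simp
      show "b < 40 \<Longrightarrow> node om b \<in> set ?p" using dset by simp
    qed
  qed
qed

section \<open>A straight-line drawing\<close>

text \<open>Integer coordinates, so that orientation tests are arithmetic on numerals. Only 40 lies
  on the vertical axis, and only 38 and 39 are as low as height 1.\<close>

definition coords :: "(real \<times> real) list" where
  "coords =
    [(19, 6), (16, 8), (8, 7), (14, 5), (19, 11), (18, 16), (16, 12), (21, 8), (22, 12),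
     (21, 17), (10, 3), (21, 3), (14, 10), (12, 10), (9, 9), (15, 15), (13, 13), (6, 9),
     (4, 7), (5, 4), (8, 11), (6, 12), (2, 4), (15, 22), (16, 18), (12, 20), (24, 17),
     (15, 25), (12, 15), (11, 12), (9, 14), (10, 17), (5, 18), (4, 14), (2, 20), (8, 17),
     (5, 23), (8, 20), (4, 1), (24, 1), (0, 25)]"

definition local_pos :: "nat \<Rightarrow> real \<times> real" where
  "local_pos a = coords ! a"

lemma length_coords: "length coords = 41"
  by (simp add: coords_def)

lemma map_local_pos: "map local_pos [0..<41] = coords"
  using map_nth[of coords] by (simp add: local_pos_def[abs_def] length_coords)

lemmas local_pos_facts = map_local_pos[unfolded upt_41 coords_def list.map list.inject]

abbreviation "px a \<equiv> fst (local_pos a)"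
abbreviation "py a \<equiv> snd (local_pos a)"

text \<open>Twice the signed area of the triangle \<open>p\<close>, \<open>q\<close>,
  \<open>r\<close>: the sign tells on which side of the line through \<open>p\<close> and
  \<open>q\<close> the point \<open>r\<close> lies.\<close>

definition orient :: "real \<times> real \<Rightarrow> real \<times> real \<Rightarrow> real \<times> real \<Rightarrow> real" where
  "orient p q r = (fst q - fst p) * (snd r - snd p) - (snd q - snd p) * (fst r - fst p)"

definition on_segment :: "real \<times> real \<Rightarrow> real \<times> real \<Rightarrow> real \<times> real \<Rightarrow> bool" where
  "on_segment r p q \<longleftrightarrow> (\<exists>u. 0 \<le> u \<and> u \<le> 1 \<and>
     fst r = (1 - u) * fst p + u * fst q \<and> snd r = (1 - u) * snd p + u * snd q)"

lemma on_segment_sym: "on_segment r p q \<longleftrightarrow> on_segment r q p"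
proof -
  have "on_segment r q p" if "on_segment r p q" for p q
  proof -
    from that obtain u where "0 \<le> u" "u \<le> 1"
        "fst r = (1 - u) * fst p + u * fst q" "snd r = (1 - u) * snd p + u * snd q"
      unfolding on_segment_def by blast
    then show ?thesis
      unfolding on_segment_def by (intro exI[of _ "1 - u"]) simp
  qed
  then show ?thesis by blast
qed

lemma orient_on_segment:
  assumes "on_segment r p q"
  shows "orient p q r = 0"
proof -
  from assms obtain u where "fst r = (1 - u) * fst p + u * fst q" "snd r = (1 - u) * snd p + u * snd q"
    unfolding on_segment_def by blast
  then show ?thesis
    unfolding orient_def by (simp only:) (simp add: algebra_simps)
qed

text \<open>\<open>orient p q\<close> is affine in its third argument, so along a segment it
  interpolates between its end values.\<close>

lemma orient_convex:
  assumes "on_segment r p' q'"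
  obtains u where "0 \<le> u" "u \<le> 1" "orient p q r = (1 - u) * orient p q p' + u * orient p q q'"
    "r = ((1 - u) * fst p' + u * fst q', (1 - u) * snd p' + u * snd q')"
proof -
  from assms obtain u where u: "0 \<le> u" "u \<le> 1"
      "fst r = (1 - u) * fst p' + u * fst q'" "snd r = (1 - u) * snd p' + u * snd q'"
    unfolding on_segment_def by blast
  have "orient p q r = (1 - u) * orient p q p' + u * orient p q q'"
    unfolding orient_def by (simp only: u(3,4)) (simp add: algebra_simps)
  with u show thesis
    by (intro that[of u]) (simp_all add: prod_eq_iff)
qed

text \<open>\<open>p'\<close> and \<open>q'\<close> lie strictly on one side of the line through
  \<open>p\<close> and \<open>q\<close>, so \<open>orient p q\<close> has no zero between
  them.\<close>

lemma segments_disjoint: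
  assumes "orient p q p' * orient p q q' > 0"
  shows "\<not> (on_segment r p q \<and> on_segment r p' q')"
proof
  assume r: "on_segment r p q \<and> on_segment r p' q'"
  then obtain u where u: "0 \<le> u" "u \<le> 1" "orient p q r = (1 - u) * orient p q p' + u * orient p q q'"
    using orient_convex[of r p' q'] by metis
  then have eq: "(1 - u) * orient p q p' + u * orient p q q' = 0"
    using orient_on_segment r by metis
  show False
  proof (cases "orient p q p' > 0")
    case True
    then have "orient p q q' > 0" using assms by (simp add: zero_less_mult_iff)
    with True u eq show False
      by (smt (verit) mult_nonneg_nonneg mult_pos_pos)
  next
    case False
    then have "orient p q p' < 0" "orient p q q' < 0" using assms by (auto simp: zero_less_mult_iff)
    with u eq show False
      by (smt (verit) mult_nonneg_nonpos mult_pos_neg)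
  qed
qed

text \<open>On the second segment \<open>orient s p\<close> equals \<open>u * orient s p q\<close>;
  on the first it is 0. This forces \<open>u = 0\<close>.\<close>

lemma segments_meet_at_corner:
  assumes "orient s p q \<noteq> 0" "on_segment r s p" "on_segment r s q"
  shows "r = s"
proof -
  obtain u where u: "orient s p r = (1 - u) * orient s p s + u * orient s p q"
      "r = ((1 - u) * fst s + u * fst q, (1 - u) * snd s + u * snd q)"
    using orient_convex[OF assms(3)] by metis
  have "orient s p s = 0" by (simp add: orient_def)
  then have "u = 0" using u orient_on_segment[OF assms(2)] assms(1) by simp
  then show ?thesis using u by simp
qed

text \<open>A computable certificate: edges with a common end are not collinear; otherwise the line
  through one edge has the other strictly on one side.\<close>

definition uncrossed :: "nat \<times> nat \<Rightarrow> nat \<times> nat \<Rightarrow> bool" where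
  "uncrossed e f \<longleftrightarrow>
    (if fst e = fst f then orient (local_pos (fst e)) (local_pos (snd e)) (local_pos (snd f)) \<noteq> 0
     else if fst e = snd f then orient (local_pos (fst e)) (local_pos (snd e)) (local_pos (fst f)) \<noteq> 0
     else if snd e = fst f then orient (local_pos (snd e)) (local_pos (fst e)) (local_pos (snd f)) \<noteq> 0
     else if snd e = snd f then orient (local_pos (snd e)) (local_pos (fst e)) (local_pos (fst f)) \<noteq> 0
     else orient (local_pos (fst e)) (local_pos (snd e)) (local_pos (fst f))
        * orient (local_pos (fst e)) (local_pos (snd e)) (local_pos (snd f)) > 0
      \<or> orient (local_pos (fst f)) (local_pos (snd f)) (local_pos (fst e))
        * orient (local_pos (fst f)) (local_pos (snd f)) (local_pos (snd e)) > 0)"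

lemma uncrossed_meet:
  assumes "uncrossed (a, b) (c, d)"
    and "on_segment r (local_pos a) (local_pos b)" "on_segment r (local_pos c) (local_pos d)"
  shows "\<exists>v \<in> {a, b} \<inter> {c, d}. r = local_pos v"
proof -
  have flip: "on_segment r (local_pos b) (local_pos a)" "on_segment r (local_pos d) (local_pos c)"
    using assms(2,3) on_segment_sym by blast+
  note corner = segments_meet_at_corner[where r = r]
  consider "a = c" | "a \<noteq> c" "a = d" | "a \<noteq> c" "a \<noteq> d" "b = c"
    | "a \<noteq> c" "a \<noteq> d" "b \<noteq> c" "b = d" | "a \<noteq> c" "a \<noteq> d" "b \<noteq> c" "b \<noteq> d"
    by blast
  then show ?thesis
  proof cases
    case 1
    then have "r = local_pos a"
      using assms by (intro corner[of "local_pos a" "local_pos b" "local_pos d"]) (auto simp: uncrossed_def)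
    with 1 show ?thesis by blast
  next
    case 2
    then have "r = local_pos a"
      using assms flip by (intro corner[of "local_pos a" "local_pos b" "local_pos c"]) (auto simp: uncrossed_def)
    with 2 show ?thesis by blast
  next
    case 3
    then have "r = local_pos b"
      using assms flip by (intro corner[of "local_pos b" "local_pos a" "local_pos d"]) (auto simp: uncrossed_def)
    with 3 show ?thesis by blast
  next
    case 4
    then have "r = local_pos b"
      using assms flip by (intro corner[of "local_pos b" "local_pos a" "local_pos c"]) (auto simp: uncrossed_def)
    with 4 show ?thesis by blast
  next
    case 5
    then have "orient (local_pos a) (local_pos b) (local_pos c) * orient (local_pos a) (local_pos b) (local_pos d) > 0
        \<or> orient (local_pos c) (local_pos d) (local_pos a) * orient (local_pos c) (local_pos d) (local_pos b) > 0"
      using assms(1) by (simp add: uncrossed_def)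
    then show ?thesis
      using assms(2,3) segments_disjoint by blast
  qed
qed

section \<open>The fragment in the first quadrant\<close>

definition fragment_edges :: "(nat \<times> nat) list" where
  "fragment_edges = filter (\<lambda>e. snd e \<noteq> 41) hypo_edges"

text \<open>With \<open>sorted_wrt\<close> each of the 2016 unordered pairs is evaluated
  once.\<close>

lemma fragment_edges_uncrossed: "sorted_wrt uncrossed fragment_edges"
  unfolding fragment_edges_def hypo_edges_def
  by (simp add: uncrossed_def orient_def local_pos_facts del: One_nat_def)

lemma fragment_adj_in_fragment_edges: "fragment_adj a b \<Longrightarrow> (a, b) \<in> set fragment_edges \<or> (b, a) \<in> set fragment_edges"
  by (auto simp: fragment_adj_def fragment_edges_def)

text \<open>These bounds keep the reflected copies apart and reserve the strip of heights between -1
  and 1 for the links.\<close>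

lemma local_pos_bounds:
  "list_all (\<lambda>a. (px a > 0 \<or> a = 40) \<and> (py a > 1 \<or> a = 38 \<or> a = 39)) [0..<41]"
  "local_pos 38 = (4, 1)" "local_pos 39 = (24, 1)" "local_pos 40 = (0, 25)"
  unfolding upt_41 list.pred_inject by (simp_all add: local_pos_facts del: One_nat_def)

lemma inj_local_pos: "inj_on local_pos {..40}"
proof -
  have "distinct (map local_pos [0..<41])"
    unfolding map_local_pos coords_def by simp
  then have "inj_on local_pos (set [0..<41])"
    by (simp only: distinct_map)
  moreover have "set [0..<41] = {..40::nat}" by auto
  ultimately show ?thesis by simp
qed

lemma sorted_wrt_pairs:
  "sorted_wrt P xs \<Longrightarrow> x \<in> set xs \<Longrightarrow> y \<in> set xs \<Longrightarrow> x \<noteq> y \<Longrightarrow> P x y \<or> P y x"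
  by (induction xs) auto

lemma local_edges_meet:
  assumes "fragment_adj a b" "fragment_adj c d" "{a, b} \<noteq> {c, d}"
    and on: "on_segment r (local_pos a) (local_pos b)" "on_segment r (local_pos c) (local_pos d)"
  shows "\<exists>v \<in> {a, b} \<inter> {c, d}. r = local_pos v"
proof -
  obtain a' b' where ab: "(a', b') \<in> set fragment_edges" "{a', b'} = {a, b}"
      "on_segment r (local_pos a') (local_pos b')"
    using fragment_adj_in_fragment_edges[OF assms(1)] on(1) on_segment_sym by (metis insert_commute)
  obtain c' d' where cd: "(c', d') \<in> set fragment_edges" "{c', d'} = {c, d}"
      "on_segment r (local_pos c') (local_pos d')"
    using fragment_adj_in_fragment_edges[OF assms(2)] on(2) on_segment_sym by (metis insert_commute)
  have "(a', b') \<noteq> (c', d')"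
    using ab(2) cd(2) assms(3) by auto
  then have "uncrossed (a', b') (c', d') \<or> uncrossed (c', d') (a', b')"
    using sorted_wrt_pairs[OF fragment_edges_uncrossed ab(1) cd(1)] by blast
  then have "\<exists>v \<in> {a', b'} \<inter> {c', d'}. r = local_pos v"
    using uncrossed_meet[OF _ ab(3) cd(3)] uncrossed_meet[OF _ cd(3) ab(3)] by blast
  then show ?thesis
    unfolding ab(2) cd(2) .
qed

lemma corners_not_adjacent:
  assumes "fragment_adj a b" "a \<in> {38, 39}"
  shows "b \<notin> {38, 39}"
proof -
  have "list_all (\<lambda>e. \<not> (fst e \<in> {38, 39} \<and> snd e \<in> {38, 39})) hypo_edges"
    unfolding hypo_edges_def by (simp only: numeral_list_simps)
  then show ?thesis
    using assms by (auto simp: fragment_adj_def list_all_iff)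
qed

lemma px_pos: "a < 40 \<Longrightarrow> px a > 0"
  and py_gt_1: "a \<le> 40 \<Longrightarrow> a \<noteq> 38 \<Longrightarrow> a \<noteq> 39 \<Longrightarrow> py a > 1"
  using local_pos_bounds(1) by (auto simp: list_all_iff)

lemma py_ge_1: "a \<le> 40 \<Longrightarrow> py a \<ge> 1"
  using py_gt_1[of a] local_pos_bounds(2,3) by (cases "a = 38 \<or> a = 39") auto

lemma px_nonneg: "a \<le> 40 \<Longrightarrow> px a \<ge> 0"
  using px_pos[of a] local_pos_bounds(4) by (cases "a = 40") auto

text \<open>The first coordinate and the height above 1 are convex combinations of nonnegative
  values. They vanish only where every term does, which is at the apex or at a corner because the
  two corners are not adjacent.\<close>

lemma on_local_edge:
  assumes h: "fragment_adj a b" and on: "on_segment r (local_pos a) (local_pos b)"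
  shows "fst r \<ge> 0" "snd r \<ge> 1"
    "fst r = 0 \<Longrightarrow> 40 \<in> {a, b} \<and> r = local_pos 40"
    "snd r = 1 \<Longrightarrow> \<exists>v \<in> {a, b} \<inter> {38, 39}. r = local_pos v"
proof -
  note ab = fragment_adj_range[OF h]
  obtain u where u: "0 \<le> u" "u \<le> 1" "fst r = (1 - u) * px a + u * px b" "snd r = (1 - u) * py a + u * py b"
    using on unfolding on_segment_def by blast
  have at_end: "u = 0 \<Longrightarrow> r = local_pos a" "u = 1 \<Longrightarrow> r = local_pos b"
    using u(3,4) by (simp_all add: prod_eq_iff)
  have nonneg: "(1 - u) * px a \<ge> 0" "u * px b \<ge> 0"
    using u ab px_nonneg by simp_all
  then show "fst r \<ge> 0" using u(3) by simp
  have nonneg': "(1 - u) * (py a - 1) \<ge> 0" "u * (py b - 1) \<ge> 0"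
    using u ab py_ge_1 by simp_all
  have snd_r: "snd r = 1 + ((1 - u) * (py a - 1) + u * (py b - 1))"
    using u(4) by (simp add: algebra_simps)
  show "snd r \<ge> 1" using snd_r nonneg' by simp
  show "40 \<in> {a, b} \<and> r = local_pos 40" if "fst r = 0"
  proof -
    have "(1 - u) * px a = 0" "u * px b = 0"
      using that u(3) nonneg by linarith+
    then have "(u = 1 \<or> a = 40) \<and> (u = 0 \<or> b = 40)"
      using px_pos[of a] px_pos[of b] ab by (auto simp: le_less)
    then show ?thesis
      using ab at_end by auto
  qed
  show "\<exists>v \<in> {a, b} \<inter> {38, 39}. r = local_pos v" if "snd r = 1"
  proof -
    have "(1 - u) * (py a - 1) = 0" "u * (py b - 1) = 0"
      using that snd_r nonneg' by linarith+
    then have *: "(u = 1 \<or> a \<in> {38, 39}) \<and> (u = 0 \<or> b \<in> {38, 39})"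
      using py_gt_1[of a] py_gt_1[of b] ab by fastforce
    have "\<not> (a \<in> {38, 39} \<and> b \<in> {38, 39})"
      using corners_not_adjacent h by blast
    then have "u = 1 \<and> b \<in> {38, 39} \<or> u = 0 \<and> a \<in> {38, 39}"
      using * by auto
    then show ?thesis
      using at_end by blast
  qed
qed

section \<open>The four reflected copies\<close>

definition sx :: "nat \<Rightarrow> real" where "sx i = (if even i then 1 else -1)"
definition sy :: "nat \<Rightarrow> real" where "sy i = (if i < 2 then 1 else -1)"

text \<open>The sign choice for the shared apexes is immaterial, as their first coordinate is 0.\<close>
definition place :: "nat \<Rightarrow> real ^ 2" where
  "place n =
    (let r = (if n < 81 then n else n - 81);
         i = (if n < 81 then 0 else 2) + (if r \<le> 40 then 0 else 1);
         a = (if r \<le> 40 then r else r - 41)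
     in vector [sx i * px a, sy i * py a])"

text \<open>\<open>place\<close> inverts \<open>node\<close>, reading a shared apex in the even
  copy; this affects only the sign of a zero coordinate.\<close>

lemma place_node:
  assumes "i < 4" "a \<le> 40"
  shows "place (node i a) = vector [sx i * px a, sy i * py a]"
proof (cases "a = 40")
  case True
  with assms local_pos_bounds(4) show ?thesis
    by (elim less_4E) (simp_all add: place_def node_def sx_def sy_def)
next
  case False
  with assms have "a < 40" by simp
  with assms(1) show ?thesis
    by (elim less_4E) (simp_all add: place_def node_def sx_def sy_def)
qed

lemma vec2_eq_iff: "(v :: real ^ 2) = vector [x, y] \<longleftrightarrow> v $ 1 = x \<and> v $ 2 = y"
  by (auto simp: vec_eq_iff forall_2)

lemma signs: "sx i \<in> {1, -1}" "sy i \<in> {1, -1}"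
  by (auto simp: sx_def sy_def)

text \<open>\<open>mate\<close> is the reflection in the vertical axis, \<open>opp\<close> the one
  in the horizontal axis.\<close>

lemma signs_copy:
  assumes "i < 4" "j < 4"
  shows "sx i = sx j \<longleftrightarrow> j \<in> {i, opp i}" "sy i = sy j \<longleftrightarrow> j \<in> {i, mate i}"
  using assms by (elim less_4E; simp add: sx_def sy_def opp_def mate_def)+

text \<open>For an edge this is the straight segment, given in a form that depends only on the
  unordered pair.\<close>

definition curve :: "nat set \<Rightarrow> (real ^ 2) set" where
  "curve e = convex hull (place ` e)"

lemma curve_pair: "q \<in> curve {s, t} \<longleftrightarrow>
    (\<exists>u. 0 \<le> u \<and> u \<le> 1 \<and> q $ 1 = (1 - u) * place s $ 1 + u * place t $ 1
       \<and> q $ 2 = (1 - u) * place s $ 2 + u * place t $ 2)"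
  by (simp add: curve_def segment_convex_hull[symmetric] closed_segment_def vec_eq_iff forall_2) blast

lemma curve_fragment:
  assumes "i < 4" "a \<le> 40" "b \<le> 40" "q \<in> curve {node i a, node i b}"
  shows "on_segment (sx i * q $ 1, sy i * q $ 2) (local_pos a) (local_pos b)"
proof -
  obtain u where u: "0 \<le> u" "u \<le> 1" "q $ 1 = (1 - u) * (sx i * px a) + u * (sx i * px b)"
      "q $ 2 = (1 - u) * (sy i * py a) + u * (sy i * py b)"
    using assms by (auto simp: curve_pair place_node)
  have "sx i * q $ 1 = (1 - u) * px a + u * px b" "sy i * q $ 2 = (1 - u) * py a + u * py b"
    unfolding u(3,4) using signs[of i] by (auto simp: algebra_simps)
  with u show ?thesis
    unfolding on_segment_def by auto
qed

text \<open>A linked pair of corners is symmetric about the horizontal axis, at heights 1 and -1, so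
  the link is vertical.\<close>

lemma curve_link:
  assumes "i < 4" "a \<in> {38, 39}" "q \<in> curve {node i a, node (opp i) a}"
  shows "q $ 1 = sx i * px a" "\<bar>q $ 2\<bar> \<le> 1"
proof -
  have o: "opp i < 4" "sx (opp i) = sx i" "sy (opp i) = - sy i"
    using assms(1) by (auto simp: sx_def sy_def opp_def elim!: less_4E)
  have a: "a \<le> 40" "py a = 1"
    using assms(2) local_pos_bounds(2,3) by auto
  obtain u where u: "0 \<le> u" "u \<le> 1" "q $ 1 = (1 - u) * (sx i * px a) + u * (sx i * px a)"
      "q $ 2 = (1 - u) * sy i - u * sy i"
    using assms o a by (auto simp: curve_pair place_node)
  show "q $ 1 = sx i * px a"
    unfolding u(3) by (simp add: algebra_simps)
  show "\<bar>q $ 2\<bar> \<le> 1"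
    using u signs(2)[of i] by auto
qed

lemma place_eqI:
  assumes "i < 4" "v \<le> 40" "(sx i * q $ 1, sy i * q $ 2) = local_pos v"
  shows "q = place (node i v)"
  unfolding place_node[OF assms(1,2)] vec2_eq_iff assms(3)[symmetric]
  using signs[of i] by auto

lemma fragment_curves_meet:
  assumes i: "i < 4" and j: "j < 4" and ab: "fragment_adj a b" and cd: "fragment_adj c d"
    and e: "e = {node i a, node i b}" and f: "f = {node j c, node j d}" and "e \<noteq> f"
    and q: "q \<in> curve e" "q \<in> curve f"
  shows "q \<in> place ` (e \<inter> f)"
proof -
  note range = fragment_adj_range[OF ab] fragment_adj_range[OF cd]
  have 1: "on_segment (sx i * q $ 1, sy i * q $ 2) (local_pos a) (local_pos b)"
    using curve_fragment[of i a b q] i range q e by auto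
  have 2: "on_segment (sx j * q $ 1, sy j * q $ 2) (local_pos c) (local_pos d)"
    using curve_fragment[of j c d q] j range q f by auto
  note bounds = on_local_edge[OF ab 1] on_local_edge[OF cd 2]
  \<comment> \<open>Both edges stay at distance at least 1 from the horizontal axis, so the sign of
    the second coordinate of \<open>q\<close> fixes \<open>sy\<close>.\<close>
  have "sy i = sy j"
    using bounds(2) bounds(6) signs(2)[of i] signs(2)[of j] by auto
  then consider "j = i" | "j = mate i"
    using signs_copy[OF i j] by auto
  then show ?thesis
  proof cases
    case 1
    have "{a, b} \<noteq> {c, d}"
      using \<open>e \<noteq> f\<close> e f 1 by (metis image_empty image_insert)
    then obtain v where v: "v \<in> {a, b} \<inter> {c, d}" "(sx i * q $ 1, sy i * q $ 2) = local_pos v"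
      using local_edges_meet[OF ab cd] \<open>on_segment _ (local_pos a) _\<close> 2 1 by auto
    then have "q = place (node i v)"
      using place_eqI[OF i] range by auto
    with v 1 e f show ?thesis by blast
  next
    case mate: 2
    \<comment> \<open>Mates lie on opposite sides of the vertical axis, so \<open>q\<close> is on
      it, and only the apex is there.\<close>
    have "sx j = - sx i"
      using i mate by (auto simp: sx_def mate_def elim!: less_4E)
    then have "sx i * q $ 1 = 0" "sx j * q $ 1 = 0"
      using bounds(1) bounds(5) by auto
    then have "40 \<in> {a, b}" "40 \<in> {c, d}" "(sx i * q $ 1, sy i * q $ 2) = local_pos 40"
      using bounds(3) bounds(7) by auto
    then have "q = place (node i 40)" "node i 40 \<in> e \<inter> f"
      using place_eqI[OF i, of 40] e f mate node_mate[OF i] by auto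
    then show ?thesis by blast
  qed
qed

text \<open>Fragment edges have distance at least 1 from the horizontal axis and links at most 1, so
  a common point is a corner; its first coordinate identifies the link.\<close>

lemma fragment_link_meet:
  assumes i: "i < 4" and j: "j < 4" and ab: "fragment_adj a b" and c: "c \<in> {38, 39}"
    and e: "e = {node i a, node i b}" and f: "f = {node j c, node (opp j) c}"
    and q: "q \<in> curve e" "q \<in> curve f"
  shows "q \<in> place ` (e \<inter> f)"
proof -
  note range = fragment_adj_range[OF ab]
  have 1: "on_segment (sx i * q $ 1, sy i * q $ 2) (local_pos a) (local_pos b)"
    using curve_fragment[of i a b q] i range q e by auto
  note bounds = on_local_edge[OF ab 1]
  have link: "q $ 1 = sx j * px c" "\<bar>q $ 2\<bar> \<le> 1"
    using curve_link[OF j c] q f by auto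
  have "sy i * q $ 2 \<le> \<bar>q $ 2\<bar>"
    using signs(2)[of i] by auto
  then have "sy i * q $ 2 = 1"
    using bounds(2) link(2) by simp
  then obtain v where v: "v \<in> {a, b} \<inter> {38, 39}" "(sx i * q $ 1, sy i * q $ 2) = local_pos v"
    using bounds(4) by auto
  then have "sx i * (sx j * px c) = px v"
    using link by (metis fst_conv)
  moreover have "px c > 0" "px v > 0" "px 38 \<noteq> px 39"
    using v c px_pos local_pos_bounds(2,3) by auto
  ultimately have "sx i = sx j" "px v = px c"
    using signs(1)[of i] signs(1)[of j] by auto
  have "v = c"
    using v(1) c \<open>px 38 \<noteq> px 39\<close> \<open>px v = px c\<close> by auto
  have "j \<in> {i, opp i}"
    using \<open>sx i = sx j\<close> signs_copy(1)[OF i j] by simp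
  have "node i v \<in> e \<inter> f"
    using \<open>v = c\<close> \<open>j \<in> {i, opp i}\<close> v e f copy_involutions[OF i] by auto
  moreover have "q = place (node i v)"
    using place_eqI[OF i _ v(2)] v by auto
  ultimately show ?thesis by blast
qed

text \<open>The constant first coordinate of a link determines the corner and \<open>sx\<close>,
  hence the copy up to \<open>opp\<close>, and opposite copies have the same link.\<close>

lemma link_curves_disjoint:
  assumes i: "i < 4" and j: "j < 4" and c: "c \<in> {38, 39}" "d \<in> {38, 39}"
    and e: "e = {node i c, node (opp i) c}" and f: "f = {node j d, node (opp j) d}"
    and q: "q \<in> curve e" "q \<in> curve f"
  shows "e = f"
proof -
  have "sx i * px c = sx j * px d"
    using curve_link(1)[OF i c(1), of q] curve_link(1)[OF j c(2), of q] q e f by simp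
  moreover have "px c > 0" "px d > 0" "px 38 \<noteq> px 39"
    using c px_pos local_pos_bounds(2,3) by auto
  ultimately have "sx i = sx j" "px c = px d"
    using signs(1)[of i] signs(1)[of j] by auto
  then have "c = d" "j \<in> {i, opp i}"
    using c \<open>px 38 \<noteq> px 39\<close> signs_copy(1)[OF i j] by auto
  then show ?thesis
    using e f copy_involutions[OF i] by auto
qed

definition edge :: "nat set \<Rightarrow> bool" where
  "edge e \<longleftrightarrow> (\<exists>s t. glued_adj s t \<and> e = {s, t})"

lemma curves_meet:
  assumes "edge e" "edge f" "e \<noteq> f" "q \<in> curve e" "q \<in> curve f"
  shows "q \<in> place ` (e \<inter> f)"
proof -
  have cases: "(\<exists>i<4. \<exists>a b. fragment_adj a b \<and> e = {node i a, node i b})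
      \<or> (\<exists>i<4. \<exists>a\<in>{38, 39}. e = {node i a, node (opp i) a})" if "edge e" for e
    using that unfolding edge_def glued_adj_def by blast
  from cases[OF assms(1)] cases[OF assms(2)] show ?thesis
  proof (elim disjE exE conjE bexE)
    fix i a b j c d
    assume "i < 4" "fragment_adj a b" "e = {node i a, node i b}" "j < 4" "fragment_adj c d" "f = {node j c, node j d}"
    then show ?thesis
      using fragment_curves_meet assms by blast
  next
    fix i a b j c
    assume "i < 4" "fragment_adj a b" "e = {node i a, node i b}" "j < 4" "c \<in> {38, 39}"
      "f = {node j c, node (opp j) c}"
    then show ?thesis
      using fragment_link_meet assms by blast
  next
    fix i a b j c
    assume "j < 4" "c \<in> {38, 39}" "e = {node j c, node (opp j) c}" "i < 4" "fragment_adj a b"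
      "f = {node i a, node i b}"
    then show ?thesis
      using fragment_link_meet[of i j a b c f e q] assms by (simp add: Int_commute)
  next
    fix i c j d
    assume "i < 4" "c \<in> {38, 39}" "e = {node i c, node (opp i) c}"
      "j < 4" "d \<in> {38, 39}" "f = {node j d, node (opp j) d}"
    then show ?thesis
      using link_curves_disjoint assms by blast
  qed
qed

text \<open>Heights are nonzero, so \<open>sy\<close> can be recovered. So can \<open>sx\<close>,
  except at an apex, where the two mates share the vertex.\<close>

lemma inj_place: "inj_on place {..<162}"
proof (rule inj_onI)
  fix n n' assume n: "n \<in> {..<162}" "n' \<in> {..<162}" "place n = place n'"
  obtain i a where ia: "i < 4" "a \<le> 40" "n = node i a"
    using n(1) by (auto intro: node_exhaust)
  obtain j b where jb: "j < 4" "b \<le> 40" "n' = node j b"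
    using n(2) by (auto intro: node_exhaust)
  have eq: "sx i * px a = sx j * px b" "sy i * py a = sy j * py b"
    using n(3) place_node[OF ia(1,2)] place_node[OF jb(1,2)] unfolding ia(3) jb(3)
    by (simp_all add: vec2_eq_iff)
  have "px a \<ge> 0" "px b \<ge> 0" "py a \<ge> 1" "py b \<ge> 1"
    using ia jb px_nonneg py_ge_1 by auto
  then have "sy i = sy j" "px a = px b" "py a = py b" "sx i = sx j \<or> px a = 0"
    using eq signs[of i] signs[of j] by auto
  then have "a = b" "j \<in> {i, mate i}" "j \<in> {i, opp i} \<or> a = 40"
    using inj_onD[OF inj_local_pos, of a b] ia jb signs_copy[OF ia(1) jb(1)] px_pos[of a]
    by (auto simp: prod_eq_iff le_less)
  then show "n = n'"
    using ia jb node_mate[OF ia(1)] copy_involutions[OF ia(1)] by auto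
qed

text \<open>Used to treat a drawn vertex as a point of an edge curve. A neighbour of
  \<open>a\<close> is one next to it on \<open>left_path\<close>.\<close>

lemma no_isolated_node:
  assumes "w < 162"
  shows "\<exists>t. glued_adj w t"
proof -
  obtain i a where ia: "i < 4" "a \<le> 40" "w = node i a"
    using assms by (auto intro: node_exhaust)
  have "a \<in> set left_path"
    using spansD(1)[OF fixed_paths_correct(8)] ia(2) by simp
  then obtain xs ys where q: "left_path = xs @ a # ys"
    by (meson split_list)
  have "\<exists>b. fragment_adj a b"
  proof (cases "ys = []")
    case True
    have "xs \<noteq> []"
    proof
      assume "xs = []"
      then have "set left_path = {a}"
        unfolding q True by simp
      with spansD(1)[OF fixed_paths_correct(8)] have "{b. b \<le> 40} = {a}"
        by simp
      then have "0 \<in> {a}" "1 \<in> {a}"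
        by (simp_all flip: \<open>{b. b \<le> 40} = {a}\<close>)
      then show False by simp
    qed
    then show ?thesis
      using fixed_paths_correct(6) fragment_adj_sym[of a] by (auto simp: q successively_append_iff)
  next
    case False
    then show ?thesis
      using fixed_paths_correct(6) by (cases ys) (auto simp: q successively_append_iff)
  qed
  then show ?thesis
    using ia unfolding glued_adj_def by blast
qed

section \<open>The theorem\<close>

definition glued_graph :: "nat pair_pre_digraph" where
  "glued_graph = \<lparr> pverts = {..<162}, parcs = {(s, t). glued_adj s t} \<rparr>"

lemma glued_adj_less: "glued_adj s t \<Longrightarrow> s < 162 \<and> t < 162"
  unfolding glued_adj_def using node_less fragment_adj_range copy_involutions(2) by fastforce

lemma glued_adj_irrefl: "glued_adj s t \<Longrightarrow> s \<noteq> t"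
proof -
  assume "glued_adj s t"
  then consider i a b where "i < 4" "fragment_adj a b" "s = node i a" "t = node i b"
    | i a where "i < 4" "a \<in> {38, 39}" "s = node i a" "t = node (opp i) a"
    unfolding glued_adj_def by blast
  then show "s \<noteq> t"
  proof cases
    case 1
    then show ?thesis using fragment_adj_range[of a b] by (auto simp: node_eq_iff)
  next
    case 2
    then have "a \<le> 40" "a \<noteq> 40" by auto
    with 2 show ?thesis using copy_involutions[of i] by (auto simp: node_eq_iff)
  qed
qed

lemma pair_graph_glued_graph: "pair_graph glued_graph"
proof
  show "finite (parcs glued_graph)"
    by (rule finite_subset[of _ "{..<162} \<times> {..<162}"]) (auto simp: glued_graph_def dest: glued_adj_less)
qed (auto simp: glued_graph_def symmetric_def intro!: symI dest: glued_adj_less glued_adj_irrefl glued_adj_sym)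

lemma planar_glued_graph: "planar (with_proj glued_graph)"
proof -
  have arcs: "arcs_ends (with_proj glued_graph) = {(s, t). glued_adj s t}"
    by (simp add: glued_graph_def)
  have edges: "undirected_edges (with_proj glued_graph) = Collect edge"
    unfolding undirected_edges_def arcs edge_def by auto
  have "plane_drawing (with_proj glued_graph) place curve"
    unfolding plane_drawing_def edges arcs
  proof (intro conjI)
    show "inj_on place (verts (with_proj glued_graph))"
      using inj_place by (simp add: glued_graph_def)
    have "\<exists>g. arc g \<and> pathstart g = place u \<and> pathfinish g = place v \<and> path_image g = curve {u, v}"
      if "glued_adj u v" for u v
    proof -
      have "place u \<noteq> place v"
        using inj_onD[OF inj_place, of u v] glued_adj_less[OF that] glued_adj_irrefl[OF that] by auto
      then show ?thesis
        by (intro exI[of _ "linepath (place u) (place v)"])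
          (simp add: arc_linepath curve_def segment_convex_hull)
    qed
    then show "\<forall>(u, v)\<in>{(s, t). glued_adj s t}. \<exists>g. arc g \<and> pathstart g = place u \<and>
        pathfinish g = place v \<and> path_image g = curve {u, v}"
      by blast
    show "\<forall>e\<in>Collect edge. curve e \<inter> place ` verts (with_proj glued_graph) \<subseteq> place ` e"
    proof (intro ballI subsetI)
      fix e q assume e: "e \<in> Collect edge" and q: "q \<in> curve e \<inter> place ` verts (with_proj glued_graph)"
      then obtain w where w: "w < 162" "q = place w"
        by (auto simp: glued_graph_def)
      obtain t where "glued_adj w t"
        using no_isolated_node[OF w(1)] by blast
      \<comment> \<open>The vertex also lies on its own edge \<open>{w, t}\<close>, so the condition
        on vertices reduces to the one on pairs of edges.\<close>
      then have f: "edge {w, t}" "q \<in> curve {w, t}"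
        unfolding edge_def curve_def w(2) by (auto intro: hull_inc)
      show "q \<in> place ` e"
      proof (cases "e = {w, t}")
        case False
        then show ?thesis
          using curves_meet[of e "{w, t}" q] e f q by auto
      qed (use w in auto)
    qed
    show "\<forall>e\<in>Collect edge. \<forall>f\<in>Collect edge. e \<noteq> f \<longrightarrow> curve e \<inter> curve f \<subseteq> place ` (e \<inter> f)"
      using curves_meet by blast
  qed
  then show ?thesis
    unfolding planar_def by blast
qed

lemma successively_vwalk_arcs:
  "successively P p \<longleftrightarrow> (\<forall>(s, t) \<in> set (vwalk_arcs p). P s t)"
  by (induction p rule: vwalk_arcs.induct) auto

lemma hypotraceable_glued_graph: "hypotraceable (with_proj glued_graph)"
  unfolding hypotraceable_def
proof (intro conjI ballI notI)
  assume "\<exists>p. hamiltonian_path (with_proj glued_graph) p"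
  then obtain p where p: "distinct p" "set p = {..<162}" "set (vwalk_arcs p) \<subseteq> {(s, t). glued_adj s t}"
    by (auto simp: hamiltonian_path_def vpath_def vwalk_def glued_graph_def)
  then have "glued_adj s t" if "used p s t" for s t
    using that glued_adj_sym by (auto simp: used_def)
  with p not_traceable show False by blast
next
  fix w assume "w \<in> verts (with_proj glued_graph)"
  then have "w < 162" by (simp add: glued_graph_def)
  then obtain i a where ia: "i < 4" "a \<le> 40" "w = node i a"
    by (rule node_exhaust)
  obtain p where p: "successively glued_adj p" "distinct p" "set p = {..<162} - {w}"
    using deleted_traceable[OF ia(1,2)] ia(3) by blast
  \<comment> \<open>\<open>vwalk\<close> demands a nonempty list; deleting one vertex cannot remove
    both 0 and 1.\<close>
  have "p \<noteq> []"
  proof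
    assume "p = []"
    with p(3) have sub: "{..<162} \<subseteq> {w}" by auto
    have "0 \<in> {w}" "1 \<in> {w}" by (rule subsetD[OF sub], simp)+
    then show False by simp
  qed
  moreover have "(s, t) \<in> arcs_ends (pre_digraph.del_vert (with_proj glued_graph) w)"
    if "(s, t) \<in> set (vwalk_arcs p)" for s t
  proof -
    have "glued_adj s t" "s \<in> set p" "t \<in> set p"
      using that p(1) vwalk_arcs_members[OF that] by (auto simp: successively_vwalk_arcs)
    then show ?thesis
      using p(3) by (auto simp: arcs_ends_def arc_to_ends_def pre_digraph.del_vert_simps glued_graph_def image_iff)
  qed
  ultimately show "\<exists>p. hamiltonian_path (pre_digraph.del_vert (with_proj glued_graph) w) p"
    using p(2,3)
    by (intro exI[of _ p])
      (auto simp: hamiltonian_path_def vpath_def vwalk_def pre_digraph.del_vert_simps glued_graph_def)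
qed

theorem mainTheorem2:
  shows "\<exists>G :: nat pair_pre_digraph.
    pair_graph G \<and> planar (with_proj G) \<and> card (pverts G) = 162 \<and> hypotraceable (with_proj G)"
  using pair_graph_glued_graph planar_glued_graph hypotraceable_glued_graph
  by (intro exI[of _ glued_graph]) (simp add: glued_graph_def)

end
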